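(* Let $\mathfrak{X}$ be a real normed linear space with a Schauder basis $(e_n)_n$, let $k\ge2$ be an integer, and let $\mathfrak{F}$ be an analytic subset of $(\mathcal{B}_{B_{\mathfrak{X}}}^\infty)^k$. Then for every sequence $\Delta=(\delta_n)_n$ of positive real numbers there is $Y\in\mathcal{B}_{\mathfrak{X}}^\infty$ such that either $(\mathcal{B}_{B_{\mathfrak{X}}}^\infty(Y))_\perp^k\cap\mathfrak{F}=\emptyset$ or $(\mathcal{B}_{B_{\mathfrak{X}}}^\infty(Y))^k\subseteq(\mathfrak{F}_\Delta)^\uparrow$.
   Context: As usual, a Schauder basis is understood to have a finite basis constant. For $x=\sum_n\lambda_ne_n$, $\mathrm{supp}\,x=\{n:\lambda_n\neq0\}$; for nonzero finitely supported $x,y$, $x<y$ means $\max\mathrm{supp}\,x<\min\mathrm{supp}\,y$. A block sequence is an infinite sequence $(x_n)_n$ of nonzero finitely supported vectors with $x_n<x_{n+1}$ for all $n$. $Y=(y_n)_n$ is a block subsequence of $Z=(z_n)_n$ ($Y\preceq Z$) if both are block sequences and each $y_n$ is in the linear span of $(z_i)_i$. $B_{\mathfrak{X}}$ is the (closed) unit ball of $\mathfrak{X}$. $\mathcal{B}_{\mathfrak{X}}^\infty$ is the set of all block sequences in $\mathfrak{X}$, $\mathcal{B}_{B_{\mathfrak{X}}}^\infty$ the set of those all of whose terms lie in $B_{\mathfrak{X}}$, and $\mathcal{B}_{B_{\mathfrak{X}}}^\infty(Z)$ the set of block subsequences of $Z$ all of whose terms lie in $B_{\mathfrak{X}}$.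 The topology of $\mathcal{B}_{B_{\mathfrak{X}}}^\infty$ is induced by the product of the norm topology on $\mathfrak{X}^{\mathbb{N}}$, and $(\mathcal{B}_{B_{\mathfrak{X}}}^\infty)^k$ has the product topology. A set is analytic if it is a continuous image of the Baire space $\mathbb{N}^{\mathbb{N}}$ (or empty). Block sequences $(z^1_n)_n$, $(z^2_n)_n$ are disjointly supported if $\mathrm{supp}\,z^1_n\cap\mathrm{supp}\,z^2_m=\emptyset$ for all $m,n$. $(\mathcal{B}_{B_{\mathfrak{X}}}^\infty(Z))_\perp^k$ is the set of all $k$-tuples of pairwise disjointly supported members of $\mathcal{B}_{B_{\mathfrak{X}}}^\infty(Z)$. For block sequences $U=(u_n)_n$, $V=(v_n)_n$, $dist(U,V)\le\Delta$ means $\|u_n-v_n\|\le\delta_n$ for all $n$. For $\mathfrak{F}\subseteq(\mathcal{B}_{\mathfrak{X}}^\infty)^k$: $$\mathfrak{F}_\Delta=\{(U_i)_{i=0}^{k-1}\in(\mathcal{B}_{\mathfrak{X}}^\infty)^k:\exists(V_i)_{i=0}^{k-1}\in\mathfrak{F}\ \forall i\ dist(U_i,V_i)\le\Delta\},$$ $$\mathfrak{F}^\uparrow=\{(U_i)_{i=0}^{k-1}\in(\mathcal{B}_{\mathfrak{X}}^\infty)^k:\exists(V_i)_{i=0}^{k-1}\in\mathfrak{F}\ \forall i\ V_i\preceq U_i\}.$$ *)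

theory Defs
  imports "HOL-Analysis.Analysis"
begin

definition coords :: "(nat \<Rightarrow> 'a::real_normed_vector) \<Rightarrow> 'a \<Rightarrow> nat \<Rightarrow> real" where
  "coords e x = (THE c. (\<lambda>n. c n *\<^sub>R e n) sums x)"

definition basis_proj :: "(nat \<Rightarrow> 'a::real_normed_vector) \<Rightarrow> nat \<Rightarrow> 'a \<Rightarrow> 'a" where
  "basis_proj e n x = (\<Sum>i<n. coords e x i *\<^sub>R e i)"

(* The space need not be complete, so finiteness of the basis constant sup_n ||P_n||
   does not follow from the unique expansions and is a separate conjunct. *)
definition schauder_basis :: "(nat \<Rightarrow> 'a::real_normed_vector) \<Rightarrow> bool" where
  "schauder_basis e \<longleftrightarrow>
     (\<forall>x. \<exists>!c. (\<lambda>n. c n *\<^sub>R e n) sums x) \<and>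
     (\<exists>C. \<forall>n x. norm (basis_proj e n x) \<le> C * norm x)"

definition supp :: "(nat \<Rightarrow> 'a::real_normed_vector) \<Rightarrow> 'a \<Rightarrow> nat set" where
  "supp e x = {n. coords e x n \<noteq> 0}"

(* Used only for nonzero finitely supported x and y. *)
definition supp_less :: "(nat \<Rightarrow> 'a::real_normed_vector) \<Rightarrow> 'a \<Rightarrow> 'a \<Rightarrow> bool" where
  "supp_less e x y \<longleftrightarrow> Max (supp e x) < Min (supp e y)"

definition block_seqs :: "(nat \<Rightarrow> 'a::real_normed_vector) \<Rightarrow> (nat \<Rightarrow> 'a) set" where
  "block_seqs e = {X. (\<forall>n. X n \<noteq> 0 \<and> finite (supp e (X n))) \<and>
                      (\<forall>n. supp_less e (X n) (X (Suc n)))}"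

definition block_subseq :: "(nat \<Rightarrow> 'a::real_normed_vector) \<Rightarrow> (nat \<Rightarrow> 'a) \<Rightarrow> (nat \<Rightarrow> 'a) \<Rightarrow> bool" where
  "block_subseq e Y Z \<longleftrightarrow>
     Y \<in> block_seqs e \<and> Z \<in> block_seqs e \<and> (\<forall>n. Y n \<in> span (range Z))"

definition ball_block_seqs :: "(nat \<Rightarrow> 'a::real_normed_vector) \<Rightarrow> (nat \<Rightarrow> 'a) set" where
  "ball_block_seqs e = {X \<in> block_seqs e. \<forall>n. X n \<in> cball 0 1}"

definition ball_block_subseqs ::
    "(nat \<Rightarrow> 'a::real_normed_vector) \<Rightarrow> (nat \<Rightarrow> 'a) \<Rightarrow> (nat \<Rightarrow> 'a) set" where
  "ball_block_subseqs e Z = {X. block_subseq e X Z \<and> (\<forall>n. X n \<in> cball 0 1)}"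

definition ball_block_topology :: "(nat \<Rightarrow> 'a::real_normed_vector) \<Rightarrow> (nat \<Rightarrow> 'a) topology" where
  "ball_block_topology e =
     subtopology (product_topology (\<lambda>_. euclidean) UNIV) (ball_block_seqs e)"

(* k-tuples of members of A are the extensional functions on {..<k}, i.e. the points of a
   product topology indexed by {..<k}. *)
abbreviation tuples :: "nat \<Rightarrow> 'b set \<Rightarrow> (nat \<Rightarrow> 'b) set" where
  "tuples k A \<equiv> {..<k} \<rightarrow>\<^sub>E A"

definition baire_space :: "(nat \<Rightarrow> nat) topology" where
  "baire_space = product_topology (\<lambda>_. discrete_topology UNIV) UNIV"

definition analytic_in :: "'b topology \<Rightarrow> 'b set \<Rightarrow> bool" where
  "analytic_in T A \<longleftrightarrow>
     A = {} \<or> (\<exists>f. continuous_map baire_space T f \<and> f ` topspace baire_space = A)"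

definition disjointly_supported ::
    "(nat \<Rightarrow> 'a::real_normed_vector) \<Rightarrow> (nat \<Rightarrow> 'a) \<Rightarrow> (nat \<Rightarrow> 'a) \<Rightarrow> bool" where
  "disjointly_supported e U V \<longleftrightarrow> (\<forall>m n. supp e (U n) \<inter> supp e (V m) = {})"

definition perp_tuples ::
    "(nat \<Rightarrow> 'a::real_normed_vector) \<Rightarrow> nat \<Rightarrow> (nat \<Rightarrow> 'a) set \<Rightarrow> (nat \<Rightarrow> nat \<Rightarrow> 'a) set" where
  "perp_tuples e k A =
     {U \<in> tuples k A. \<forall>i<k. \<forall>j<k. i \<noteq> j \<longrightarrow> disjointly_supported e (U i) (U j)}"

definition dist_le ::
    "(nat \<Rightarrow> 'a::real_normed_vector) \<Rightarrow> (nat \<Rightarrow> 'a) \<Rightarrow> (nat \<Rightarrow> real) \<Rightarrow> bool" where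
  "dist_le U V \<delta> \<longleftrightarrow> (\<forall>n. norm (U n - V n) \<le> \<delta> n)"

definition expansion ::
    "(nat \<Rightarrow> 'a::real_normed_vector) \<Rightarrow> nat \<Rightarrow> (nat \<Rightarrow> real) \<Rightarrow>
     (nat \<Rightarrow> nat \<Rightarrow> 'a) set \<Rightarrow> (nat \<Rightarrow> nat \<Rightarrow> 'a) set" where
  "expansion e k \<delta> F =
     {U \<in> tuples k (block_seqs e). \<exists>V\<in>F. \<forall>i<k. dist_le (U i) (V i) \<delta>}"

definition upward ::
    "(nat \<Rightarrow> 'a::real_normed_vector) \<Rightarrow> nat \<Rightarrow> (nat \<Rightarrow> nat \<Rightarrow> 'a) set \<Rightarrow> (nat \<Rightarrow> nat \<Rightarrow> 'a) set" where
  "upward e k F =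
     {U \<in> tuples k (block_seqs e). \<exists>V\<in>F. \<forall>i<k. block_subseq e (V i) (U i)}"

end

(* A vector is replaced by a nearby one whose coordinates lie in a fixed countable lattice. The rounding
   preserves supports and is additive on disjointly supported vectors, and by the choice of the mesh
   it moves the l-th term of any block sequence by at most delta_l / 2. The rounded vectors are the
   moves in two games: in the asymptotic game player I chooses tails of a block sequence q, in Gowers'
   game arbitrary block subsequences of q, and player II answers with vectors from their spans. Round n
   contributes to the (n mod k)-th member of a k-tuple, and each play comes with a point of the Baire
   space that parametrises a member of F and says which moves add up to the terms of a tuple close to it.

   Diagonalising over the countably many positions gives q such that either I has a strategy in
   the asymptotic game to prevent II from approximating F, or II can approximate F whatever
   fixed sequence of block subsequences of q is played against it. In the first case let Y be a
   subsequence of q that grows so fast that every disjointly supported tuple of block subsequences of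
   Y in the unit ball can be played against the strategy, so none of them lies in F. In the second case
   take a tuple U below Y = q and play U_i in the rounds congruent to i modulo k. *)

theory Submission imports Defs begin

section \<open>Spaces with tails, and fusion over countably many conditions\<close>

text \<open>\<open>le p p\<close> expresses admissibility of \<open>p\<close>: \<open>le\<close>
  becomes \<open>block_subseq\<close>, which holds only between block sequences.
  \<open>tl n p\<close> becomes the \<open>n\<close>-th tail, and \<open>pts p\<close> the set of
  moves that \<open>p\<close> offers.\<close>

locale asymptotic_space =
  fixes le :: "'p \<Rightarrow> 'p \<Rightarrow> bool" and tl :: "nat \<Rightarrow> 'p \<Rightarrow> 'p" and pts :: "'p \<Rightarrow> 'd set" and D :: "'d set"
  assumes le_refl_left: "le p q \<Longrightarrow> le p p"
    and le_refl_right: "le p q \<Longrightarrow> le q q"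
    and le_trans: "le p q \<Longrightarrow> le q r \<Longrightarrow> le p r"
    and tl_le: "le p p \<Longrightarrow> le (tl n p) p"
    and tl_0: "tl 0 p = p"
    and tl_tl: "tl n (tl m p) = tl (m + n) p"
    and tl_le_tl: "le p q \<Longrightarrow> \<exists>n. le (tl n p) (tl m q)"
    and pts_mono: "le p q \<Longrightarrow> pts p \<subseteq> pts q"
    and pts_D: "le p p \<Longrightarrow> pts p \<subseteq> D"
    and countable_D: "countable D"
    and diagonal: "le (s 0) (s 0) \<Longrightarrow> (\<And>n. le (s (Suc n)) (s n)) \<Longrightarrow>
      \<exists>q. le q (s 0) \<and> (\<forall>n. \<exists>m. le (tl m q) (s n))"
begin

text \<open>The order up to finitely many terms, which is all that a diagonal sequence satisfies
  with respect to every member of a decreasing sequence.\<close>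

definition almost_le :: "'p \<Rightarrow> 'p \<Rightarrow> bool" where
  "almost_le q p \<longleftrightarrow> le q q \<and> (\<exists>m. le (tl m q) p)"

lemma le_imp_almost_le: "le q p \<Longrightarrow> almost_le q p"
  unfolding almost_le_def using le_refl_left tl_0 by metis

lemma tl_antimono:
  assumes "le p p" "m \<le> n"
  shows "le (tl n p) (tl m p)"
proof -
  have "le (tl m p) (tl m p)" using tl_le[OF assms(1)] le_refl_left by blast
  from tl_le[OF this, of "n - m"] show ?thesis using assms(2) by (simp add: tl_tl)
qed

lemma almost_le_tl:
  assumes "almost_le q p"
  obtains n where "le (tl n q) (tl m p)"
proof -
  from assms obtain j where "le (tl j q) p" unfolding almost_le_def by blast
  from tl_le_tl[OF this, of m] obtain n where "le (tl n (tl j q)) (tl m p)" by blast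
  with that show ?thesis by (simp add: tl_tl)
qed

lemma almost_le_lower:
  assumes "almost_le q p" "le r q"
  obtains n where "le (tl n r) p" "le (tl n r) r"
proof -
  from assms obtain m where m: "le (tl m q) p" unfolding almost_le_def by blast
  from tl_le_tl[OF assms(2), of m] obtain n where "le (tl n r) (tl m q)" by blast
  with m that show ?thesis using le_trans tl_le le_refl_left assms(2) by blast
qed

text \<open>Fusion along an enumeration of \<open>C\<close>: step \<open>n\<close> passes to a
  subspace with property \<open>c n\<close> whenever some subspace has it. The diagonal sequence
  inherits every decision because \<open>\<Phi>\<close> is stable under
  \<open>almost_le\<close>.\<close>

lemma stabilise:
  fixes \<Phi> :: "'p \<Rightarrow> 's \<Rightarrow> bool"
  assumes "countable C" and "le p p"
    and mono: "\<And>p q s. almost_le q p \<Longrightarrow> s \<in> C \<Longrightarrow> \<Phi> p s \<Longrightarrow> \<Phi> q s"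
  shows "\<exists>q. le q p \<and> (\<forall>r s. le r q \<longrightarrow> s \<in> C \<longrightarrow> \<Phi> r s \<longrightarrow> \<Phi> q s)"
proof (cases "C = {}")
  case True
  then show ?thesis using assms(2) by blast
next
  case False
  define c where "c = from_nat_into C"
  have c: "c i \<in> C" for i unfolding c_def using False by (rule from_nat_into)
  have "\<exists>P. \<forall>n. ((n = 0 \<longrightarrow> P n = p) \<and> le (P n) (P n)) \<and>
      (le (P (Suc n)) (P n) \<and> ((\<exists>r. le r (P n) \<and> \<Phi> r (c n)) \<longrightarrow> \<Phi> (P (Suc n)) (c n)))"
  proof (rule dependent_nat_choice)
    show "\<exists>x. (0 = (0::nat) \<longrightarrow> x = p) \<and> le x x" using assms(2) by blast
  next
    fix x and n :: nat assume "(n = 0 \<longrightarrow> x = p) \<and> le x x"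
    then show "\<exists>y. ((Suc n = 0 \<longrightarrow> y = p) \<and> le y y) \<and>
       le y x \<and> ((\<exists>r. le r x \<and> \<Phi> r (c n)) \<longrightarrow> \<Phi> y (c n))"
      using le_refl_left by blast
  qed
  then obtain P where P: "P 0 = p" "\<And>n. le (P (Suc n)) (P n)"
    "\<And>n r. le r (P n) \<Longrightarrow> \<Phi> r (c n) \<Longrightarrow> \<Phi> (P (Suc n)) (c n)" by metis
  from diagonal[of P] P assms(2) obtain q where q: "le q p" "\<And>n. \<exists>m. le (tl m q) (P n)" by auto
  have qP: "almost_le q (P n)" for n
    unfolding almost_le_def using q le_refl_left by blast
  have "\<Phi> q s" if r: "le r q" and "s \<in> C" "\<Phi> r s" for r s
  proof -
    from that(2) obtain i where s: "s = c i" unfolding c_def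
      using assms(1) by (metis from_nat_into_surj)
    \<comment> \<open>A tail of \<open>r\<close> lies below \<open>P i\<close> itself, so the
      property was attainable when \<open>c i\<close> was treated.\<close>
    obtain n where n: "le (tl n r) (P i)" "le (tl n r) r"
      by (rule almost_le_lower[OF qP[of i] r])
    have "\<Phi> (tl n r) s" using mono[OF le_imp_almost_le[OF n(2)] that(2,3)] .
    then have "\<Phi> (P (Suc i)) s" using P(3) n(1) s by blast
    then show ?thesis using mono[OF qP] that(2) by blast
  qed
  then show ?thesis using q(1) by blast
qed

end

section \<open>The two games and their dichotomy\<close>

text \<open>\<open>A\<close> is a Souslin scheme of plays: \<open>A t\<close> stands for the plays
  that have a parameter in the Baire space extending \<open>t\<close>, and \<open>A_branch\<close>
  reads off its next digit.\<close>

locale analytic_game = asymptotic_space le tl pts D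
  for le :: "'p \<Rightarrow> 'p \<Rightarrow> bool" and tl :: "nat \<Rightarrow> 'p \<Rightarrow> 'p" and pts :: "'p \<Rightarrow> 'd set" and D :: "'d set" +
  fixes A :: "nat list \<Rightarrow> (nat \<Rightarrow> 'd) set"
  assumes A_branch: "A t \<subseteq> (\<Union>b. A (t @ [b]))"
begin

text \<open>In the asymptotic game below \<open>p\<close> player I plays tails of \<open>p\<close> and II a point of each of them.
  Starting from the position \<open>u\<close>, the strategy \<open>\<sigma>\<close> of I keeps the play outside \<open>A t\<close>.\<close>

definition avoids :: "'p \<Rightarrow> 'd list \<Rightarrow> nat list \<Rightarrow> ('d list \<Rightarrow> nat) \<Rightarrow> bool" where
  "avoids p u t \<sigma> \<longleftrightarrow> (\<forall>x. (\<forall>i<length u. x i = u ! i) \<longrightarrow>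
     (\<forall>i\<ge>length u. x i \<in> pts (tl (\<sigma> (map x [0..<i])) p)) \<longrightarrow> x \<notin> A t)"

definition wins :: "'p \<Rightarrow> 'd list \<times> nat list \<Rightarrow> bool" where
  "wins p s \<longleftrightarrow> (\<exists>\<sigma>. avoids p (fst s) (snd s) \<sigma>)"

text \<open>In \<open>q\<close>, player I answers with tails that lie below those which the strategy
  prescribes in \<open>p\<close>.\<close>

lemma wins_mono:
  assumes "almost_le q p" "wins p s"
  shows "wins q s"
proof -
  from assms(2) obtain \<sigma> where \<sigma>: "avoids p (fst s) (snd s) \<sigma>" unfolding wins_def by blast
  have "\<exists>n. le (tl n q) (tl (\<sigma> u) p)" for u using almost_le_tl[OF assms(1)] by metis
  then obtain \<tau> where "\<And>u. le (tl (\<tau> u) q) (tl (\<sigma> u) p)" by metis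
  then have "pts (tl (\<tau> u) q) \<subseteq> pts (tl (\<sigma> u) p)" for u using pts_mono by blast
  then have "avoids q (fst s) (snd s) \<tau>" using \<sigma> unfolding avoids_def by blast
  then show ?thesis unfolding wins_def by blast
qed

text \<open>In Gowers' game I may play any subspace below \<open>p\<close>. The least fixed point replaces the ordinal
  ranks of the positions from which player II wins the open game with target \<open>N\<close>.\<close>

inductive forces :: "'p \<Rightarrow> ('d list \<Rightarrow> bool) \<Rightarrow> 'd list \<Rightarrow> bool"
  for p :: 'p and N :: "'d list \<Rightarrow> bool" where
  target: "N u \<Longrightarrow> forces p N u"
| move: "(\<And>r. le r p \<Longrightarrow> \<exists>x\<in>pts r. forces p N (u @ [x])) \<Longrightarrow> forces p N u"

text \<open>A subspace \<open>r\<close> of \<open>q\<close> is answered through a tail of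
  \<open>r\<close> that lies below \<open>p\<close>.\<close>

lemma forces_mono:
  assumes "almost_le q p" "forces p N u"
  shows "forces q N u"
  using assms(2)
proof induction
  case (target u)
  then show ?case by (rule forces.target)
next
  case (move u)
  show ?case
  proof (rule forces.move)
    fix r assume "le r q"
    from almost_le_lower[OF assms(1) this] obtain n where n: "le (tl n r) p" "le (tl n r) r" .
    then show "\<exists>x\<in>pts r. forces q N (u @ [x])" using move[OF n(1)] pts_mono[OF n(2)] by blast
  qed
qed

text \<open>Well-foundedness of the least fixed point makes the play against the prescribed moves
  \<open>Q\<close> reach the target after finitely many rounds.\<close>

lemma forces_path:
  assumes "forces p N u" "\<And>n. le (Q n) p"
  shows "\<exists>v. N (u @ v) \<and> (\<forall>i<length v. v ! i \<in> pts (Q (length u + i)))"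
  using assms(1)
proof induction
  case (target u)
  then show ?case by (intro exI[of _ "[]"]) auto
next
  case (move u)
  from move[OF assms(2)[of "length u"]] obtain x v where xv: "x \<in> pts (Q (length u))" "N ((u @ [x]) @ v)"
    "\<forall>i<length v. v ! i \<in> pts (Q (length (u @ [x]) + i))" by blast
  have "(x # v) ! i \<in> pts (Q (length u + i))" if "i < length (x # v)" for i
    using that xv(1,3) by (cases i) auto
  then show ?case using xv(2) by (intro exI[of _ "x # v"]) auto
qed

lemma unforced_strategy:
  assumes "\<not> forces p N u"
  obtains r where "le r p" "\<And>x. x \<in> pts r \<Longrightarrow> \<not> forces p N (u @ [x])"
proof -
  have "\<exists>r. le r p \<and> (\<forall>x\<in>pts r. \<not> forces p N (u @ [x]))"
    using assms forces.move by blast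
  then show ?thesis using that by blast
qed

text \<open>Player II is only allowed to choose a digit that is smaller than the number of moves made since
  the previous digit. Hence, if II cannot force such a choice, then at every round I has to follow
  only finitely many strategies, one for each digit chosen so far.\<close>

definition branch :: "'p \<Rightarrow> 'd list \<times> nat list \<Rightarrow> 'd list \<Rightarrow> bool" where
  "branch p s u \<longleftrightarrow> (\<exists>v. u = fst s @ v \<and> (\<exists>b<length v. \<not> wins p (u, snd s @ [b])))"

text \<open>While \<open>branch\<close> is avoided, I wins against the digit \<open>b\<close> from
  the position \<open>b + 1\<close> moves after \<open>u\<close>. From there on I obeys a strategy
  for \<open>A (t @ [b])\<close> in addition to \<open>\<sigma>\<close>. At each round only finitely
  many strategies have started, and the deepest of their tails obeys them all.\<close>

lemma wins_if_branch_avoided: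
  assumes "le p p"
    and avoid: "\<And>x. (\<forall>i<length u. x i = u ! i) \<Longrightarrow>
        (\<forall>i\<ge>length u. x i \<in> pts (tl (\<sigma> (map x [0..<i])) p)) \<Longrightarrow>
        \<forall>i\<ge>length u. \<not> branch p (u, t) (map x [0..<i])"
  shows "wins p (u, t)"
proof -
  define \<tau> where "\<tau> w b = (SOME \<tau>. avoids p w (t @ [b]) \<tau>)" for w b
  have \<tau>: "avoids p w (t @ [b]) (\<tau> w b)" if "wins p (w, t @ [b])" for w b
    using that someI_ex[of "avoids p w (t @ [b])"] unfolding wins_def \<tau>_def by simp
  \<comment> \<open>\<open>take\<close> yields the position at which the strategy for
    \<open>b\<close> starts. If this start lies beyond \<open>w\<close>, it yields \<open>w\<close>
    itself, and the extra entry can only deepen the tail.\<close>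
  define \<rho> where "\<rho> w = Max (insert (\<sigma> w) ((\<lambda>b. \<tau> (take (length u + Suc b) w) b w) ` {..<length w}))" for w
  have fin: "finite (insert (\<sigma> w) ((\<lambda>b. \<tau> (take (length u + Suc b) w) b w) ` {..<length w}))" for w
    by simp
  have pts_le: "pts (tl n p) \<subseteq> pts (tl m p)" if "m \<le> n" for m n
    using pts_mono tl_antimono[OF assms(1) that] by blast
  have "avoids p u t \<rho>"
    unfolding avoids_def
  proof (intro allI impI)
    fix x assume xu: "\<forall>i<length u. x i = u ! i"
      and x: "\<forall>i\<ge>length u. x i \<in> pts (tl (\<rho> (map x [0..<i])) p)"
    have "\<sigma> w \<le> \<rho> w" for w unfolding \<rho>_def by (rule Max_ge[OF fin]) simp
    then have "\<forall>i\<ge>length u. x i \<in> pts (tl (\<sigma> (map x [0..<i])) p)" using x pts_le by blast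
    from avoid[OF xu this] have nb: "\<And>i. i \<ge> length u \<Longrightarrow> \<not> branch p (u, t) (map x [0..<i])" by blast
    have "x \<notin> A (t @ [b])" for b
    proof -
      \<comment> \<open>The first position at which the condition \<open>b<length v\<close> in
        \<open>branch\<close> admits the digit \<open>b\<close>.\<close>
      define n where "n = length u + Suc b"
      define w where "w = map x [0..<n]"
      have u: "map x [0..<length u] = u" using xu by (intro nth_equalityI) auto
      have "w = u @ map x [length u..<n]"
      proof -
        have "[0..<n] = [0..<length u] @ [length u..<n]"
          unfolding n_def by (metis le_add1 upt_add_eq_append zero_le add_0)
        then show ?thesis unfolding w_def using u by simp
      qed
      moreover have "b < length (map x [length u..<n])" unfolding n_def by simp
      ultimately have "wins p (w, t @ [b])" using nb[of n] unfolding branch_def w_def n_def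
        by (metis fst_conv snd_conv le_add1)
      from \<tau>[OF this] have av: "avoids p w (t @ [b]) (\<tau> w b)" .
      have 1: "\<forall>i<length w. x i = w ! i" unfolding w_def by simp
      have "\<tau> w b (map x [0..<i]) \<le> \<rho> (map x [0..<i])" if "i \<ge> n" for i
      proof -
        have "take n (map x [0..<i]) = w" unfolding w_def using that by (simp add: take_map take_upt)
        then have "\<tau> w b (map x [0..<i]) \<in> (\<lambda>b. \<tau> (take (length u + Suc b) (map x [0..<i])) b (map x [0..<i])) ` {..<length (map x [0..<i])}"
          using that unfolding n_def by (intro image_eqI[of _ _ b]) auto
        then show ?thesis unfolding \<rho>_def by (intro Max_ge[OF fin]) blast
      qed
      then have 2: "\<forall>i\<ge>length w. x i \<in> pts (tl (\<tau> w b (map x [0..<i])) p)"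
        using x pts_le unfolding w_def
        by (metis diff_zero le_add1 length_map length_upt n_def order_trans subsetD)
      show ?thesis using av 1 2 unfolding avoids_def by blast
    qed
    then show "x \<notin> A t" using A_branch by blast
  qed
  then show ?thesis unfolding wins_def by auto
qed

text \<open>Otherwise every strategy of I, for instance the constant one, would avoid
  \<open>A t\<close> from \<open>u\<close>.\<close>

lemma losing_position_extends:
  assumes "\<not> wins p (u, t)"
  shows "\<exists>y\<in>A t. \<forall>i<length u. y i = u ! i"
proof -
  have "\<not> avoids p u t (\<lambda>_. 0)" using assms unfolding wins_def by auto
  then show ?thesis unfolding avoids_def by blast
qed

definition states :: "('d list \<times> nat list) set" where
  "states = lists D \<times> UNIV"

lemma countable_states: "countable states"
  unfolding states_def using countable_D by (intro countable_SIGMA) auto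

text \<open>Three fusions stabilise \<open>wins\<close>, then \<open>forces\<close>, then the
  existence of a tail that keeps a position unforced. The last one converts I's arbitrary subspaces
  in Gowers' game into tails. So if II could not force a branching, I could avoid it in the
  asymptotic game and would win by \<open>wins_if_branch_avoided\<close>.\<close>

lemma lower_stable:
  assumes p: "le p p"
  obtains q where "le q p"
    "\<And>s. s \<in> states \<Longrightarrow> \<not> wins q s \<Longrightarrow> forces q (branch q s) (fst s)"
proof -
  obtain q1 where q1: "le q1 p" "\<And>r s. le r q1 \<Longrightarrow> s \<in> states \<Longrightarrow> wins r s \<Longrightarrow> wins q1 s"
    using stabilise[OF countable_states p, of wins] wins_mono by metis
  have q1': "wins r s \<longleftrightarrow> wins q1 s" if "le r q1" "s \<in> states" for r s
    using q1(2)[OF that] wins_mono[OF le_imp_almost_le[OF that(1)]] by blast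
  let ?C = "states \<times> lists D"
  have C: "countable ?C" using countable_states countable_D by (intro countable_SIGMA) auto
  \<comment> \<open>The target is frozen at \<open>q1\<close>, since \<open>forces_mono\<close>
    compares games with the same target. Below \<open>q1\<close> it agrees with
    \<open>branch\<close> on positions over \<open>D\<close>.\<close>
  define N where "N = branch q1"
  have "\<exists>q2. le q2 q1 \<and> (\<forall>r s. le r q2 \<longrightarrow> s \<in> ?C \<longrightarrow> forces r (N (fst s)) (snd s) \<longrightarrow> forces q2 (N (fst s)) (snd s))"
    by (rule stabilise[OF C le_refl_left[OF q1(1)]]) (use forces_mono in blast)
  then obtain q2 where q2: "le q2 q1"
    "\<And>r s u. le r q2 \<Longrightarrow> s \<in> states \<Longrightarrow> u \<in> lists D \<Longrightarrow> forces r (N s) u \<Longrightarrow> forces q2 (N s) u"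
    by fastforce
  \<comment> \<open>With \<open>q2\<close> fixed inside \<open>\<Phi>\<close>, shrinking
    \<open>p\<close> only removes points. By the choice of \<open>q2\<close>, \<open>forces\<close>
    with these targets no longer changes below it.\<close>
  define \<Phi> where "\<Phi> p c \<longleftrightarrow> (\<exists>n. \<forall>x\<in>pts (tl n p). \<not> forces q2 (N (fst c)) (snd c @ [x]))" for p c
  have "\<exists>q3. le q3 q2 \<and> (\<forall>r s. le r q3 \<longrightarrow> s \<in> ?C \<longrightarrow> \<Phi> r s \<longrightarrow> \<Phi> q3 s)"
  proof (rule stabilise[OF C le_refl_left[OF q2(1)]])
    fix p q s assume "almost_le q p" "\<Phi> p s"
    then show "\<Phi> q s" unfolding \<Phi>_def using almost_le_tl pts_mono by (metis subset_iff)
  qed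
  then obtain q3 where q3: "le q3 q2" "\<And>r c. le r q3 \<Longrightarrow> c \<in> ?C \<Longrightarrow> \<Phi> r c \<Longrightarrow> \<Phi> q3 c" by blast
  have q31: "le q3 q1" using q3(1) q2(1) le_trans by blast
  have b: "branch q3 s u \<longleftrightarrow> N s u" if "u \<in> lists D" for s u
    using q1'[OF q31] that unfolding N_def branch_def states_def by auto
  have f2: "forces q3 (N s) u \<longleftrightarrow> forces q2 (N s) u" if "s \<in> states" "u \<in> lists D" for s u
    using forces_mono[OF le_imp_almost_le[OF q3(1)]] q2(2)[OF q3(1) that] by blast
  \<comment> \<open>The two targets agree on words over \<open>D\<close>, and all moves below
    \<open>q\<close> lie in \<open>D\<close>, so the induction never leaves such words.\<close>
  have fN: "forces q (branch q3 s) u" if "forces q (N s) u" "u \<in> lists D" "le q q" for s u q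
    using that
  proof induction
    case (target u)
    then show ?case using b forces.target by blast
  next
    case (move u)
    show ?case
    proof (rule forces.move)
      fix r assume r: "le r q"
      from move.IH[OF r] obtain x where x: "x \<in> pts r"
        "u @ [x] \<in> lists D \<longrightarrow> le q q \<longrightarrow> forces q (branch q3 s) (u @ [x])" by blast
      have "x \<in> D" using x(1) pts_D[OF le_refl_left[OF r]] by blast
      then show "\<exists>x\<in>pts r. forces q (branch q3 s) (u @ [x])" using x move.prems by auto
    qed
  qed
  \<comment> \<open>The third fusion trades a subspace \<open>r\<close> without forcing answers for
    a tail of \<open>q3\<close> with the same property.\<close>
  have step: "\<exists>n. \<forall>x\<in>pts (tl n q3). \<not> forces q2 (N s) (u @ [x])"
    if su: "s \<in> states" "u \<in> lists D" and nf: "\<not> forces q2 (N s) u" for s u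
  proof -
    have "\<not> forces q3 (N s) u" using f2 su nf by blast
    then obtain r where r: "le r q3" "\<And>x. x \<in> pts r \<Longrightarrow> \<not> forces q3 (N s) (u @ [x])"
      using unforced_strategy by metis
    have "\<not> forces q2 (N s) (u @ [x])" if "x \<in> pts r" for x
      using r(2)[OF that] forces_mono[OF le_imp_almost_le[OF q3(1)]] by blast
    then have "\<Phi> r (s, u)" unfolding \<Phi>_def using tl_0 by (intro exI[of _ 0]) simp
    from q3(2)[OF r(1) _ this] su show ?thesis unfolding \<Phi>_def by auto
  qed
  have "forces q3 (branch q3 s) (fst s)" if s: "s \<in> states" and nw: "\<not> wins q3 s" for s
  proof (rule ccontr)
    assume nb: "\<not> forces q3 (branch q3 s) (fst s)"
    obtain u t where ut: "s = (u, t)" by (cases s)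
    have uD: "u \<in> lists D" using s ut unfolding states_def by auto
    have nf: "\<not> forces q2 (N s) u" 
      using nb fN[OF _ uD le_refl_left[OF q3(1)]] f2[OF s uD] ut by auto
    define \<sigma> where "\<sigma> w = (SOME n. \<forall>x\<in>pts (tl n q3). \<not> forces q2 (N s) (w @ [x]))" for w
    have \<sigma>: "\<not> forces q2 (N s) (w @ [x])" if "w \<in> lists D" "\<not> forces q2 (N s) w" "x \<in> pts (tl (\<sigma> w) q3)" for w x
      using someI_ex[OF step[OF s that(1,2)]] that(3) unfolding \<sigma>_def by blast
    have "wins q3 (u, t)"
    proof (rule wins_if_branch_avoided[OF le_refl_left[OF q3(1)], where \<sigma> = \<sigma>], intro allI impI)
      fix x i
      assume xu: "\<forall>i<length u. x i = u ! i" and x: "\<forall>i\<ge>length u. x i \<in> pts (tl (\<sigma> (map x [0..<i])) q3)"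
        and i: "length u \<le> i"
      have u: "map x [0..<length u] = u" using xu by (intro nth_equalityI) auto
      from i have *: "map x [0..<i] \<in> lists D \<and> \<not> forces q2 (N s) (map x [0..<i])"
      proof (induction i rule: dec_induct)
        case base
        then show ?case using u nf uD by metis
      next
        case (step j)
        have xj: "x j \<in> pts (tl (\<sigma> (map x [0..<j])) q3)" using x step(1) by blast
        have "x j \<in> D" using xj pts_D tl_le le_refl_left q3(1) by blast
        then show ?case using \<sigma>[OF _ _ xj] step by auto
      qed
      then have "\<not> N s (map x [0..<i])" using forces.target by blast
      then show "\<not> branch q3 (u, t) (map x [0..<i])" using b * ut by blast
    qed
    then show False using nw ut by blast
  qed
  then show ?thesis using that[of q3] q31 q1(1) le_trans by blast
qed

text \<open>If I does not win from the empty position, II keeps forcing branchings. Each stage adds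
  finitely many moves and one digit and ends at a position still not won by I, hence one extended by
  a member of the scheme. Whether the limit play belongs to the scheme is left to a closedness
  argument.\<close>

theorem asymptotic_dichotomy:
  assumes "le p p"
  shows "\<exists>q. le q p \<and> ((\<exists>\<sigma>. avoids q [] [] \<sigma>) \<or>
    (\<forall>Q. (\<forall>n. le (Q n) q) \<longrightarrow> (\<exists>x \<beta>. (\<forall>n. x n \<in> pts (Q n)) \<and>
       (\<forall>j. \<exists>y\<in>A (map \<beta> [0..<j]). \<forall>i<j. y i = x i))))"
proof -
  obtain q where q: "le q p"
    "\<And>s. s \<in> states \<Longrightarrow> \<not> wins q s \<Longrightarrow> forces q (branch q s) (fst s)"
    using lower_stable[OF assms] by metis
  have "\<exists>x \<beta>. (\<forall>n. x n \<in> pts (Q n)) \<and> (\<forall>j. \<exists>y\<in>A (map \<beta> [0..<j]). \<forall>i<j. y i = x i)"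
    if nw: "\<not> wins q ([], [])" and Q: "\<And>n. le (Q n) q" for Q
  proof -
    define good where "good s \<longleftrightarrow> s \<in> states \<and> \<not> wins q s \<and> (\<forall>i<length (fst s). fst s ! i \<in> pts (Q i))" for s
    have "\<exists>S. \<forall>n. (good (S n) \<and> length (snd (S n)) = n) \<and>
       (\<exists>v b. v \<noteq> [] \<and> fst (S (Suc n)) = fst (S n) @ v \<and> snd (S (Suc n)) = snd (S n) @ [b])"
    proof (rule dependent_nat_choice)
      show "\<exists>s. good s \<and> length (snd s) = 0"
        using nw by (intro exI[of _ "([], [])"]) (simp add: good_def states_def)
    next
      fix s and n :: nat assume s: "good s \<and> length (snd s) = n"
      obtain u t where ut: "s = (u, t)" by (cases s)
      from s have "forces q (branch q s) u" using q(2) ut unfolding good_def by auto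
      from forces_path[OF this, of Q] Q obtain v where v: "branch q s (u @ v)"
        "\<forall>i<length v. v ! i \<in> pts (Q (length u + i))" by blast
      then obtain b where b: "b < length v" "\<not> wins q (u @ v, t @ [b])"
        unfolding branch_def ut by auto
      have "v ! i \<in> D" if "i < length v" for i using v(2) that pts_D[OF le_refl_left[OF Q]] by blast
      then have "set v \<subseteq> D" by (metis in_set_conv_nth subsetI)
      moreover have "(u @ v) ! i \<in> pts (Q i)" if "i < length (u @ v)" for i
      proof (cases "i < length u")
        case True
        then show ?thesis using s ut unfolding good_def by (simp add: nth_append)
      next
        case False
        then show ?thesis using v(2)[rule_format, of "i - length u"] that by (simp add: nth_append)
      qed
      ultimately have "good (u @ v, t @ [b])" using b(2) s ut unfolding good_def states_def by auto
      moreover have "v \<noteq> []" using b(1) by auto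
      ultimately show "\<exists>y. (good y \<and> length (snd y) = Suc n) \<and>
          (\<exists>v b. v \<noteq> [] \<and> fst y = fst s @ v \<and> snd y = snd s @ [b])"
        using s ut by (intro exI[of _ "(u @ v, t @ [b])"]) auto
    qed
    then obtain S where S: "\<And>n. good (S n)" "\<And>n. length (snd (S n)) = n"
      "\<And>n. \<exists>v b. v \<noteq> [] \<and> fst (S (Suc n)) = fst (S n) @ v \<and> snd (S (Suc n)) = snd (S n) @ [b]" by blast
    have len: "n \<le> length (fst (S n))" for n
    proof (induction n)
      case (Suc n)
      obtain v where "v \<noteq> []" "fst (S (Suc n)) = fst (S n) @ v" using S(3) by blast
      then show ?case using Suc by (cases v) auto
    qed simp
    have ext: "\<exists>v w. fst (S n) = fst (S m) @ v \<and> snd (S n) = snd (S m) @ w" if "m \<le> n" for m n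
      using that
    proof (induction n rule: dec_induct)
      case (step n)
      then show ?case using S(3)[of n] by fastforce
    qed auto
    \<comment> \<open>Stage \<open>Suc n\<close> has at least \<open>Suc n\<close> moves and exactly
      \<open>Suc n\<close> digits, so entry \<open>n\<close> of both is available there and never
      changes later.\<close>
    define x where "x n = fst (S (Suc n)) ! n" for n
    define \<beta> where "\<beta> n = snd (S (Suc n)) ! n" for n
    have x: "fst (S m) ! i = x i" if "i < length (fst (S m))" for m i
    proof (cases "m \<le> Suc i")
      case True
      then show ?thesis using ext[OF True] that unfolding x_def by (auto simp: nth_append)
    next
      case False
      then have "Suc i \<le> m" by simp
      from ext[OF this] show ?thesis using len[of "Suc i"] unfolding x_def by (auto simp: nth_append)
    qed
    have \<beta>: "snd (S j) = map \<beta> [0..<j]" for j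
    proof (rule nth_equalityI)
      fix i assume "i < length (snd (S j))"
      then have i: "i < j" using S(2) by simp
      then have "Suc i \<le> j" by simp
      from ext[OF this] show "snd (S j) ! i = map \<beta> [0..<j] ! i"
        using i S(2)[of "Suc i"] unfolding \<beta>_def by (auto simp: nth_append)
    qed (simp add: S(2))
    have "x n \<in> pts (Q n)" for n
      using S(1)[of "Suc n"] len[of "Suc n"] unfolding good_def x_def by auto
    moreover have "\<exists>y\<in>A (map \<beta> [0..<j]). \<forall>i<j. y i = x i" for j
    proof -
      have "\<not> wins q (fst (S j), snd (S j))" using S(1)[of j] unfolding good_def by simp
      from losing_position_extends[OF this] show ?thesis using x[of _ j] len[of j] \<beta>[of j]
        by (metis order_less_le_trans)
    qed
    ultimately show ?thesis by blast
  qed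
  then show ?thesis using q(1) unfolding wins_def by auto
qed

end

section \<open>Coordinates, supports and block sequences\<close>

locale schauder =
  fixes e :: "nat \<Rightarrow> 'a::real_normed_vector"
  assumes basis: "schauder_basis e"
begin

lemma coords_sums: "(\<lambda>n. coords e x n *\<^sub>R e n) sums x"
proof -
  have "\<exists>!c. (\<lambda>n. c n *\<^sub>R e n) sums x" using basis unfolding schauder_basis_def by blast
  then show ?thesis unfolding coords_def by (rule theI')
qed

lemma coords_unique:
  assumes "(\<lambda>n. c n *\<^sub>R e n) sums x"
  shows "coords e x = c"
  using basis coords_sums[of x] assms unfolding schauder_basis_def by blast

lemma coords_inject: "coords e x = coords e y \<Longrightarrow> x = y"
  using coords_sums[of x] coords_sums[of y] sums_unique2 by metis

lemma coords_0 [simp]: "coords e 0 n = 0"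
  using coords_unique[of "\<lambda>_. 0" 0] by simp

lemma coords_add [simp]: "coords e (x + y) n = coords e x n + coords e y n"
  using coords_unique[of "\<lambda>n. coords e x n + coords e y n" "x + y"]
    sums_add[OF coords_sums[of x] coords_sums[of y]] by (simp add: scaleR_add_left)

lemma coords_scaleR [simp]: "coords e (a *\<^sub>R x) n = a * coords e x n"
  using coords_unique[of "\<lambda>n. a * coords e x n" "a *\<^sub>R x"]
    bounded_linear.sums[OF bounded_linear_scaleR_right coords_sums[of x], of a] by simp

lemma coords_sum [simp]: "coords e (sum f S) n = (\<Sum>i\<in>S. coords e (f i) n)"
  by (induction S rule: infinite_finite_induct) auto

lemma coords_basis [simp]: "coords e (e m) n = (if n = m then 1 else 0)"
proof -
  have "(\<lambda>n. (if n = m then 1 else 0) *\<^sub>R e n) sums e m"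
    using sums_If_finite_set[of "{m}" e] by (simp add: if_distrib[of "\<lambda>c. c *\<^sub>R _"] cong: if_cong)
  from coords_unique[OF this] show ?thesis by simp
qed

lemma basis_nonzero [simp]: "e m \<noteq> 0"
  using coords_basis[of m m] coords_0[of m] by (metis zero_neq_one)

lemma coords_finite_sum:
  "finite S \<Longrightarrow> coords e (\<Sum>m\<in>S. c m *\<^sub>R e m) n = (if n \<in> S then c n else 0)"
  by (simp add: if_distrib[of "\<lambda>x. _ * x"] cong: if_cong)

lemma finite_expansion:
  assumes "finite S" "supp e x \<subseteq> S"
  shows "x = (\<Sum>m\<in>S. coords e x m *\<^sub>R e m)"
proof (rule coords_inject, rule ext)
  show "coords e x n = coords e (\<Sum>m\<in>S. coords e x m *\<^sub>R e m) n" for n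
    unfolding coords_finite_sum[OF assms(1)] using assms(2) by (auto simp: supp_def)
qed

lemma supp_empty_iff [simp]: "supp e x = {} \<longleftrightarrow> x = 0"
  using finite_expansion[of "{}" x] by (auto simp: supp_def)

lemma coords_eq_0: "n \<notin> supp e x \<Longrightarrow> coords e x n = 0"
  unfolding supp_def by simp

text \<open>A term of the expansion is the difference of two consecutive basis projections. Hence
  each coordinate is bounded on the unit ball.\<close>

lemma coords_bound: "\<exists>C. \<forall>x m. \<bar>coords e x m\<bar> * norm (e m) \<le> C * norm x"
proof -
  obtain C where C: "\<And>n x. norm (basis_proj e n x) \<le> C * norm x"
    using basis unfolding schauder_basis_def by blast
  have "\<bar>coords e x m\<bar> * norm (e m) \<le> (2 * C) * norm x" for x m
  proof -
    have "coords e x m *\<^sub>R e m = basis_proj e (Suc m) x - basis_proj e m x"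
      unfolding basis_proj_def by simp
    then have "\<bar>coords e x m\<bar> * norm (e m) = norm (basis_proj e (Suc m) x - basis_proj e m x)"
      by (metis norm_scaleR)
    also have "\<dots> \<le> norm (basis_proj e (Suc m) x) + norm (basis_proj e m x)" by (rule norm_triangle_ineq4)
    also have "\<dots> \<le> (2 * C) * norm x" using C[of "Suc m" x] C[of m x] by simp
    finally show ?thesis .
  qed
  then show ?thesis by blast
qed

definition proj :: "nat set \<Rightarrow> 'a \<Rightarrow> 'a" where
  "proj S x = (\<Sum>m\<in>S. coords e x m *\<^sub>R e m)"

lemma coords_proj: "finite S \<Longrightarrow> coords e (proj S x) n = (if n \<in> S then coords e x n else 0)"
  unfolding proj_def by (rule coords_finite_sum)

lemma supp_proj: "finite S \<Longrightarrow> supp e (proj S x) = supp e x \<inter> S"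
  by (auto simp: supp_def coords_proj)

lemma block_seqs_iff:
  "X \<in> block_seqs e \<longleftrightarrow> (\<forall>n. X n \<noteq> 0 \<and> finite (supp e (X n)) \<and>
     (\<forall>a\<in>supp e (X n). \<forall>b\<in>supp e (X (Suc n)). a < b))"
proof (cases "\<forall>n. X n \<noteq> 0 \<and> finite (supp e (X n))")
  case True
  then have "supp_less e (X n) (X (Suc n)) \<longleftrightarrow> (\<forall>a\<in>supp e (X n). \<forall>b\<in>supp e (X (Suc n)). a < b)" for n
    unfolding supp_less_def by (simp add: Ball_def) blast
  then show ?thesis using True unfolding block_seqs_def by simp
next
  case False
  then show ?thesis unfolding block_seqs_def by blast
qed

lemma block_nonzero: "X \<in> block_seqs e \<Longrightarrow> X n \<noteq> 0"
  and block_finite: "X \<in> block_seqs e \<Longrightarrow> finite (supp e (X n))"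
  unfolding block_seqs_iff by blast+

lemma block_less:
  assumes X: "X \<in> block_seqs e" and "m < n" "a \<in> supp e (X m)" "b \<in> supp e (X n)"
  shows "a < b"
  using assms(2,4)
proof (induction n arbitrary: b)
  case (Suc n)
  show ?case
  proof (cases "m = n")
    case True
    then show ?thesis using X assms(3) Suc.prems unfolding block_seqs_iff by blast
  next
    case False
    obtain c where c: "c \<in> supp e (X n)" using block_nonzero[OF X, of n] supp_empty_iff by blast
    have "a < c" using Suc.IH[OF _ c] Suc.prems(1) False by simp
    also have "c < b" using X c Suc.prems(2) unfolding block_seqs_iff by blast
    finally show ?thesis .
  qed
qed simp

lemma block_disjoint:
  assumes "X \<in> block_seqs e" "a \<in> supp e (X m)" "a \<in> supp e (X n)"
  shows "m = n"
  using block_less[OF assms(1) _ assms(2,3)] block_less[OF assms(1) _ assms(3,2)]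
  by (metis less_irrefl linorder_neqE_nat)

text \<open>Each earlier term occupies at least one smaller position. The bound is the same for all
  block sequences, so a single mesh can control the \<open>l\<close>-th terms of all of
  them.\<close>

lemma block_supp_ge:
  assumes X: "X \<in> block_seqs e" and "a \<in> supp e (X n)"
  shows "n \<le> a"
  using assms(2)
proof (induction n arbitrary: a)
  case (Suc n)
  obtain c where c: "c \<in> supp e (X n)" using block_nonzero[OF X, of n] supp_empty_iff by blast
  have "c < a" using block_less[OF X _ c Suc.prems] by simp
  then show ?case using Suc.IH[OF c] by simp
qed simp

lemma block_subsequence:
  assumes X: "X \<in> block_seqs e" and g: "strict_mono g"
  shows "(\<lambda>n. X (g n)) \<in> block_seqs e"
  using block_nonzero[OF X] block_finite[OF X] block_less[OF X strict_monoD[OF g, OF lessI]]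
  unfolding block_seqs_iff by blast

lemma basis_block: "e \<in> block_seqs e"
  unfolding block_seqs_iff by (simp add: supp_def)

text \<open>Distinct blocks have disjoint supports, so every coordinate of \<open>v\<close> comes
  from at most one block.\<close>

lemma span_block:
  assumes z: "z \<in> block_seqs e" and v: "v \<in> span (range z)"
  obtains a where "finite {j. a j \<noteq> 0}" "v = (\<Sum>j | a j \<noteq> 0. a j *\<^sub>R z j)"
    "\<And>j m. m \<in> supp e (z j) \<Longrightarrow> coords e v m = a j * coords e (z j) m"
    "\<And>m. m \<notin> (\<Union>j. supp e (z j)) \<Longrightarrow> coords e v m = 0"
proof -
  have "\<exists>a. finite {j. a j \<noteq> 0} \<and> v = (\<Sum>j | a j \<noteq> 0. a j *\<^sub>R z j)"
    using v
  proof (induction rule: span_induct_alt)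
    case base
    show ?case by (intro exI[of _ "\<lambda>_. 0"]) simp
  next
    case (step c x y)
    obtain i where i: "x = z i" using step(1) by blast
    obtain a where a: "finite {j. a j \<noteq> 0}" "y = (\<Sum>j | a j \<noteq> 0. a j *\<^sub>R z j)" using step by blast
    let ?b = "a(i := a i + c)"
    let ?S = "insert i {j. a j \<noteq> 0}"
    have S: "finite ?S" using a(1) by simp
    have sub: "{j. ?b j \<noteq> 0} \<subseteq> ?S" by auto
    have y: "y = (\<Sum>j\<in>?S. a j *\<^sub>R z j)" unfolding a(2) by (rule sum.mono_neutral_left[OF S]) auto
    have "(\<Sum>j | ?b j \<noteq> 0. ?b j *\<^sub>R z j) = (\<Sum>j\<in>?S. ?b j *\<^sub>R z j)"
      by (rule sum.mono_neutral_left[OF S sub]) auto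
    also have "\<dots> = (\<Sum>j\<in>?S. a j *\<^sub>R z j + (if j = i then c *\<^sub>R z i else 0))"
      by (intro sum.cong) (auto simp: scaleR_add_left)
    also have "\<dots> = c *\<^sub>R x + y" unfolding sum.distrib y using S i by simp
    finally show ?case using finite_subset[OF sub S] by (intro exI[of _ ?b]) auto
  qed
  then obtain a where a: "finite {j. a j \<noteq> 0}" "v = (\<Sum>j | a j \<noteq> 0. a j *\<^sub>R z j)" by blast
  have c: "coords e v m = (\<Sum>j | a j \<noteq> 0. a j * coords e (z j) m)" for m unfolding a(2) by simp
  have "coords e v m = a j * coords e (z j) m" if m: "m \<in> supp e (z j)" for j m
  proof -
    have 0: "coords e (z i) m = 0" if "i \<noteq> j" for i
      using block_disjoint[OF z _ m] that coords_eq_0 by blast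
    have "coords e v m = (\<Sum>i\<in>{i. a i \<noteq> 0}. if i = j then a j * coords e (z j) m else 0)"
      unfolding c by (intro sum.cong) (auto simp: 0)
    also have "\<dots> = a j * coords e (z j) m" using a(1) by simp
    finally show ?thesis .
  qed
  moreover have "coords e v m = 0" if "m \<notin> (\<Union>j. supp e (z j))" for m
    unfolding c using that by (intro sum.neutral) (auto simp: supp_def)
  ultimately show ?thesis using that a by blast
qed

lemma span_finite_supp:
  assumes z: "z \<in> block_seqs e" and v: "v \<in> span (range z)"
  shows "finite (supp e v)"
proof -
  obtain a where a: "finite {j. a j \<noteq> 0}"
    "\<And>j m. m \<in> supp e (z j) \<Longrightarrow> coords e v m = a j * coords e (z j) m"
    "\<And>m. m \<notin> (\<Union>j. supp e (z j)) \<Longrightarrow> coords e v m = 0" by (rule span_block[OF assms]) blast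
  have "supp e v \<subseteq> (\<Union>j\<in>{j. a j \<noteq> 0}. supp e (z j))"
  proof
    fix m assume m: "m \<in> supp e v"
    then obtain j where j: "m \<in> supp e (z j)" using a(3)[of m] by (auto simp: supp_def)
    then show "m \<in> (\<Union>j\<in>{j. a j \<noteq> 0}. supp e (z j))" using a(2)[OF j] m by (auto simp: supp_def)
  qed
  then show ?thesis using a(1) block_finite[OF z] by (meson finite_UN_I finite_subset)
qed

text \<open>A nonzero coefficient affects its whole block, so a vector of the span can be cut along
  complete blocks.\<close>

lemma span_block_supp:
  assumes z: "z \<in> block_seqs e" and v: "v \<in> span (range z)"
  shows "supp e v = (\<Union>j\<in>{j. supp e (z j) \<subseteq> supp e v}. supp e (z j))"
    and "m \<in> supp e (z j) \<Longrightarrow> m \<in> supp e v \<Longrightarrow> supp e (z j) \<subseteq> supp e v"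
    and "proj (supp e (z j)) v \<in> span {z j}"
proof -
  obtain a where a:
    "\<And>j m. m \<in> supp e (z j) \<Longrightarrow> coords e v m = a j * coords e (z j) m"
    "\<And>m. m \<notin> (\<Union>j. supp e (z j)) \<Longrightarrow> coords e v m = 0" by (rule span_block[OF assms]) blast
  show *: "supp e (z j) \<subseteq> supp e v" if "m \<in> supp e (z j)" "m \<in> supp e v" for m j
  proof
    fix n assume n: "n \<in> supp e (z j)"
    have "a j \<noteq> 0" using a(1)[OF that(1)] that(2) by (auto simp: supp_def)
    then show "n \<in> supp e v" using a(1)[OF n] n by (simp add: supp_def)
  qed
  show "supp e v = (\<Union>j\<in>{j. supp e (z j) \<subseteq> supp e v}. supp e (z j))"
  proof (intro equalityI subsetI)
    fix m assume m: "m \<in> supp e v"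
    then obtain j where "m \<in> supp e (z j)" using a(2)[of m] by (auto simp: supp_def)
    then show "m \<in> (\<Union>j\<in>{j. supp e (z j) \<subseteq> supp e v}. supp e (z j))" using * m by blast
  qed blast
  have "proj (supp e (z j)) v = (\<Sum>m\<in>supp e (z j). a j *\<^sub>R coords e (z j) m *\<^sub>R e m)"
    unfolding proj_def by (intro sum.cong) (simp_all add: a(1))
  also have "\<dots> = a j *\<^sub>R z j"
    using finite_expansion[OF block_finite[OF z, of j] subset_refl] by (metis scaleR_sum_right)
  finally show "proj (supp e (z j)) v \<in> span {z j}" by (simp add: span_base span_scale)
qed

definition tail :: "nat \<Rightarrow> (nat \<Rightarrow> 'a) \<Rightarrow> nat \<Rightarrow> 'a" where
  "tail n X = (\<lambda>i. X (n + i))"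

lemma tail_block: "X \<in> block_seqs e \<Longrightarrow> tail n X \<in> block_seqs e"
  unfolding tail_def by (rule block_subsequence) (simp_all add: strict_mono_def)

lemma span_tail:
  assumes z: "z \<in> block_seqs e" and v: "v \<in> span (range z)"
    and 0: "\<And>j. j < m \<Longrightarrow> supp e v \<inter> supp e (z j) = {}"
  shows "v \<in> span (range (tail m z))"
proof -
  obtain a where a: "v = (\<Sum>j | a j \<noteq> 0. a j *\<^sub>R z j)"
    "\<And>j m. m \<in> supp e (z j) \<Longrightarrow> coords e v m = a j * coords e (z j) m" by (rule span_block[OF z v]) blast
  have "m \<le> j" if "a j \<noteq> 0" for j
  proof (rule ccontr)
    assume "\<not> m \<le> j"
    then have "supp e v \<inter> supp e (z j) = {}" using 0 by simp
    moreover obtain n where n: "n \<in> supp e (z j)" using block_nonzero[OF z, of j] supp_empty_iff by blast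
    ultimately have "coords e v n = 0" using coords_eq_0 by blast
    then show False using a(2)[OF n] n that by (simp add: supp_def)
  qed
  then have "z j \<in> range (tail m z)" if "a j \<noteq> 0" for j
    unfolding tail_def using that by (intro image_eqI[of _ _ "j - m"]) auto
  then show ?thesis unfolding a(1) by (intro span_sum span_scale span_base) simp
qed

lemma block_subseq_refl: "X \<in> block_seqs e \<Longrightarrow> block_subseq e X X"
  unfolding block_subseq_def by (auto intro: span_base)

lemma block_subseq_span: "block_subseq e X Y \<Longrightarrow> span (range X) \<subseteq> span (range Y)"
  unfolding block_subseq_def by (metis image_subsetI span_minimal subspace_span)

lemma block_subseq_trans:
  assumes "block_subseq e X Y" "block_subseq e Y Z"
  shows "block_subseq e X Z"
  using assms block_subseq_span[OF assms(2)] unfolding block_subseq_def by blast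

lemma tail_block_subseq: "X \<in> block_seqs e \<Longrightarrow> block_subseq e (tail n X) X"
  unfolding block_subseq_def by (auto simp: tail_block) (simp add: tail_def span_base)

lemma tail_tail_block_subseq:
  assumes "block_subseq e X Y"
  shows "\<exists>n. block_subseq e (tail n X) (tail m Y)"
proof -
  have X: "X \<in> block_seqs e" and Y: "Y \<in> block_seqs e" and XY: "\<And>n. X n \<in> span (range Y)"
    using assms unfolding block_subseq_def by auto
  \<comment> \<open>From index \<open>n\<close> on, the supports of \<open>X\<close> lie beyond the
    first \<open>m\<close> blocks of \<open>Y\<close>; \<open>insert 0\<close> covers
    \<open>m = 0\<close>.\<close>
  define n where "n = Suc (Max (insert 0 (\<Union>j<m. supp e (Y j))))"
  have n: "a < n" if "a \<in> supp e (Y j)" "j < m" for a j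
    unfolding n_def less_Suc_eq_le using that block_finite[OF Y] by (intro Max_ge) auto
  have "tail n X i \<in> span (range (tail m Y))" for i
  proof (rule span_tail[OF Y])
    show "tail n X i \<in> span (range Y)" using XY by (simp add: tail_def)
    show "supp e (tail n X i) \<inter> supp e (Y j) = {}" if "j < m" for j
      using n[OF _ that] block_supp_ge[OF X, of _ "n + i"] by (fastforce simp: tail_def)
  qed
  then have "block_subseq e (tail n X) (tail m Y)"
    unfolding block_subseq_def using tail_block X Y by simp
  then show ?thesis by blast
qed

text \<open>One term is taken from each \<open>s n\<close>, with index larger than every position in
  the support of the term before. As the spans decrease, all terms from the \<open>n\<close>-th on
  lie in the span of \<open>s n\<close>.\<close>

lemma block_diagonal:
  assumes "\<And>n. block_subseq e (s (Suc n)) (s n)"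
  shows "\<exists>q. block_subseq e q (s 0) \<and> (\<forall>n. \<exists>m. block_subseq e (tail m q) (s n))"
proof -
  have s: "s n \<in> block_seqs e" for n using assms[of n] unfolding block_subseq_def by blast
  have dec: "span (range (s n)) \<subseteq> span (range (s m))" if "m \<le> n" for m n
    using that
  proof (induction n rule: dec_induct)
    case (step n)
    then show ?case using block_subseq_span[OF assms[of n]] by blast
  qed simp
  have "\<exists>f. \<forall>n. True \<and> (\<forall>a\<in>supp e (s n (f n)). \<forall>b\<in>supp e (s (Suc n) (f (Suc n))). a < b)"
  proof (rule dependent_nat_choice)
    fix x n :: nat
    have "\<forall>a\<in>supp e (s n x). \<forall>b\<in>supp e (s (Suc n) (Suc (Max (supp e (s n x))))). a < b"
      using block_supp_ge[OF s] Max_ge[OF block_finite[OF s]] by (meson Suc_le_eq le_less_trans)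
    then show "\<exists>y. True \<and> (\<forall>a\<in>supp e (s n x). \<forall>b\<in>supp e (s (Suc n) y). a < b)" by blast
  qed simp
  then obtain f where f: "\<And>n a b. a \<in> supp e (s n (f n)) \<Longrightarrow> b \<in> supp e (s (Suc n) (f (Suc n))) \<Longrightarrow> a < b"
    by blast
  define q where "q n = s n (f n)" for n
  have q: "q \<in> block_seqs e"
    unfolding block_seqs_iff q_def using f block_nonzero[OF s] block_finite[OF s] by blast
  have "q (n + i) \<in> span (range (s n))" for n i
    unfolding q_def using dec[of n "n + i"] span_base[of "s (n + i) (f (n + i))"] by auto
  then have "block_subseq e (tail n q) (s n)" for n
    unfolding block_subseq_def using tail_block q s by (simp add: tail_def)
  moreover have "tail 0 q = q" by (simp add: tail_def)
  ultimately show ?thesis by metis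
qed

end

section \<open>Rounding to a countable lattice\<close>

text \<open>Rounding away from zero keeps nonzero coordinates nonzero, hence preserves supports.\<close>

definition round_away :: "real \<Rightarrow> int" where
  "round_away c = (if c \<ge> 0 then \<lceil>c\<rceil> else \<lfloor>c\<rfloor>)"

lemma round_away_eq_0_iff [simp]: "round_away c = 0 \<longleftrightarrow> c = 0"
  unfolding round_away_def by (auto simp: ceiling_eq_iff floor_eq_iff)

lemma round_away_error: "\<bar>of_int (round_away c) - c\<bar> \<le> 1"
  unfolding round_away_def by (auto simp: abs_le_iff) linarith+

locale rounding = schauder e for e :: "nat \<Rightarrow> 'a::real_normed_vector" +
  fixes \<eta> :: "nat \<Rightarrow> real"
  assumes \<eta>_pos: "\<eta> m > 0"
begin

definition rounded :: "'a \<Rightarrow> 'a" where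
  "rounded v = (\<Sum>m\<in>supp e v. (\<eta> m * of_int (round_away (coords e v m / \<eta> m))) *\<^sub>R e m)"

lemma coords_rounded:
  assumes "finite (supp e v)"
  shows "coords e (rounded v) m = \<eta> m * of_int (round_away (coords e v m / \<eta> m))"
  unfolding rounded_def coords_finite_sum[OF assms] by (auto simp: supp_def round_away_def)

lemma supp_rounded [simp]: "finite (supp e v) \<Longrightarrow> supp e (rounded v) = supp e v"
  using \<eta>_pos by (auto simp: supp_def coords_rounded less_imp_neq[symmetric])

text \<open>At each position at most one summand has a nonzero coordinate, and 0 is rounded to
  0.\<close>

lemma rounded_sum:
  assumes "finite S" and fin: "\<And>i. i \<in> S \<Longrightarrow> finite (supp e (v i))"
    and disj: "\<And>i j. i \<in> S \<Longrightarrow> j \<in> S \<Longrightarrow> i \<noteq> j \<Longrightarrow> supp e (v i) \<inter> supp e (v j) = {}"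
  shows "rounded (\<Sum>i\<in>S. v i) = (\<Sum>i\<in>S. rounded (v i))"
proof (rule coords_inject, rule ext)
  fix m
  have "supp e (\<Sum>i\<in>S. v i) \<subseteq> (\<Union>i\<in>S. supp e (v i))"
    by (auto simp: supp_def intro: ccontr dest: sum.not_neutral_contains_not_neutral)
  then have fs: "finite (supp e (\<Sum>i\<in>S. v i))" using assms(1) fin by (meson finite_UN_I finite_subset)
  define h where "h c = \<eta> m * of_int (round_away (c / \<eta> m))" for c
  have h0: "h 0 = 0" unfolding h_def by simp
  have h: "h (\<Sum>i\<in>S. coords e (v i) m) = (\<Sum>i\<in>S. h (coords e (v i) m))"
  proof (cases "\<exists>i\<in>S. m \<in> supp e (v i)")
    case True
    then obtain i where i: "i \<in> S" "m \<in> supp e (v i)" by blast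
    have 0: "coords e (v j) m = 0" if "j \<in> S - {i}" for j
      using disj[OF i(1), of j] that i(2) coords_eq_0 by blast
    show ?thesis using sum.remove[OF assms(1) i(1), of "\<lambda>i. coords e (v i) m"]
        sum.remove[OF assms(1) i(1), of "\<lambda>i. h (coords e (v i) m)"] 0 h0 by simp
  next
    case False
    then have "\<forall>i\<in>S. coords e (v i) m = 0" using coords_eq_0 by blast
    then show ?thesis using h0 by simp
  qed
  show "coords e (rounded (\<Sum>i\<in>S. v i)) m = coords e (\<Sum>i\<in>S. rounded (v i)) m"
    using h fin unfolding coords_rounded[OF fs] by (simp add: coords_rounded h_def)
qed

lemma rounded_error:
  assumes "finite (supp e v)"
  shows "norm (rounded v - v) \<le> (\<Sum>m\<in>supp e v. \<eta> m * norm (e m))"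
proof -
  have "rounded v - v = (\<Sum>m\<in>supp e v. (\<eta> m * of_int (round_away (coords e v m / \<eta> m)) - coords e v m) *\<^sub>R e m)"
    using finite_expansion[OF assms subset_refl] unfolding rounded_def
    by (simp add: scaleR_diff_left sum_subtractf)
  also have "norm \<dots> \<le> (\<Sum>m\<in>supp e v. \<eta> m * norm (e m))"
  proof (rule sum_norm_le)
    fix m
    have "\<eta> m * of_int (round_away (coords e v m / \<eta> m)) - coords e v m =
        \<eta> m * (of_int (round_away (coords e v m / \<eta> m)) - coords e v m / \<eta> m)"
      using \<eta>_pos[of m] by (simp add: right_diff_distrib)
    then have "\<bar>\<eta> m * of_int (round_away (coords e v m / \<eta> m)) - coords e v m\<bar> \<le> \<eta> m * 1"
      using \<eta>_pos[of m] round_away_error by (simp add: abs_mult)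
    then show "norm ((\<eta> m * of_int (round_away (coords e v m / \<eta> m)) - coords e v m) *\<^sub>R e m) \<le> \<eta> m * norm (e m)"
      by (simp add: mult_right_mono)
  qed
  finally show ?thesis .
qed

text \<open>Indexing by finite lists of integers makes countability immediate.\<close>

definition lattice :: "'a set" where
  "lattice = range (\<lambda>l. \<Sum>m<length l. (\<eta> m * of_int (l ! m)) *\<^sub>R e m)"

lemma rounded_in_lattice:
  assumes "finite (supp e v)"
  shows "rounded v \<in> lattice"
proof -
  define N where "N = Suc (Max (insert 0 (supp e v)))"
  have N: "supp e (rounded v) \<subseteq> {..<N}"
    using assms unfolding N_def by (auto simp: less_Suc_eq_le)
  have "rounded v = (\<Sum>m<N. (\<eta> m * of_int (round_away (coords e v m / \<eta> m))) *\<^sub>R e m)"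
    using finite_expansion[OF _ N] by (simp add: coords_rounded[OF assms])
  also have "\<dots> = (\<lambda>l. \<Sum>m<length l. (\<eta> m * of_int (l ! m)) *\<^sub>R e m)
      (map (\<lambda>m. round_away (coords e v m / \<eta> m)) [0..<N])"
    by simp
  finally show ?thesis unfolding lattice_def by blast
qed

text \<open>Each of the \<open>M\<close> coordinates is an integer multiple of
  \<open>\<eta> m\<close>, and the integer is bounded by \<open>K m\<close>, whose
  \<open>+ 1\<close> absorbs the rounding error.\<close>

lemma finite_bounded_rounded:
  "finite {rounded w | w. supp e w \<subseteq> {..<M} \<and> (\<forall>m. \<bar>coords e w m\<bar> \<le> B m)}"
proof -
  define K where "K m = \<lceil>B m / \<eta> m\<rceil> + 1" for m
  define T where "T = {..<M} \<rightarrow>\<^sub>E {- Max (K ` {..<M})..Max (K ` {..<M})}"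
  have "finite T" unfolding T_def by (intro finite_PiE) auto
  moreover have "{rounded w | w. supp e w \<subseteq> {..<M} \<and> (\<forall>m. \<bar>coords e w m\<bar> \<le> B m)} \<subseteq>
      (\<lambda>r. \<Sum>m<M. (\<eta> m * of_int (r m)) *\<^sub>R e m) ` T"
  proof clarify
    fix w assume w: "supp e w \<subseteq> {..<M}" "\<forall>m. \<bar>coords e w m\<bar> \<le> B m"
    then have fin: "finite (supp e w)" using finite_subset by blast
    define r where "r = restrict (\<lambda>m. round_away (coords e w m / \<eta> m)) {..<M}"
    have "\<bar>round_away (coords e w m / \<eta> m)\<bar> \<le> Max (K ` {..<M})" if "m < M" for m
    proof -
      have "\<bar>coords e w m / \<eta> m\<bar> \<le> B m / \<eta> m" using w(2) \<eta>_pos[of m] by (simp add: divide_right_mono)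
      then have "\<bar>of_int (round_away (coords e w m / \<eta> m))\<bar> \<le> B m / \<eta> m + 1"
        using round_away_error[of "coords e w m / \<eta> m"] by linarith
      then have "\<bar>round_away (coords e w m / \<eta> m)\<bar> \<le> K m" unfolding K_def by linarith
      also have "\<dots> \<le> Max (K ` {..<M})" using that by simp
      finally show ?thesis .
    qed
    then have "r \<in> T" unfolding r_def T_def by (force simp: abs_le_iff)
    moreover have "rounded w = (\<Sum>m<M. (\<eta> m * of_int (r m)) *\<^sub>R e m)"
      using finite_expansion[of "{..<M}" "rounded w"] w(1) fin by (simp add: coords_rounded r_def)
    ultimately show "rounded w \<in> (\<lambda>r. \<Sum>m<M. (\<eta> m * of_int (r m)) *\<^sub>R e m) ` T" by blast
  qed
  ultimately show ?thesis using finite_surj by blast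
qed

text \<open>Moves are roundings of vectors of the span and need not lie in the span themselves;
  \<open>decode_play\<close> later recovers vectors that do.\<close>

sublocale asymptotic_space "block_subseq e" tail "\<lambda>p. rounded ` span (range p)" lattice
proof
  show "block_subseq e p q \<Longrightarrow> block_subseq e p p" for p q
    unfolding block_subseq_def by (auto intro: span_base)
  show "block_subseq e p q \<Longrightarrow> block_subseq e q q" for p q
    unfolding block_subseq_def by (auto intro: span_base)
  show "block_subseq e p q \<Longrightarrow> block_subseq e q r \<Longrightarrow> block_subseq e p r" for p q r
    by (rule block_subseq_trans)
  show "block_subseq e p p \<Longrightarrow> block_subseq e (tail n p) p" for n p
    using tail_block_subseq unfolding block_subseq_def by blast
  show "tail 0 p = p" for p unfolding tail_def by simp
  show "tail n (tail m p) = tail (m + n) p" for m n p unfolding tail_def by (simp add: add.assoc)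
  show "block_subseq e p q \<Longrightarrow> \<exists>n. block_subseq e (tail n p) (tail m q)" for m p q
    by (rule tail_tail_block_subseq)
  show "block_subseq e p q \<Longrightarrow> rounded ` span (range p) \<subseteq> rounded ` span (range q)" for p q
    using block_subseq_span by (intro image_mono)
  show "block_subseq e p p \<Longrightarrow> rounded ` span (range p) \<subseteq> lattice" for p
    using rounded_in_lattice span_finite_supp unfolding block_subseq_def by blast
  show "countable lattice" unfolding lattice_def by simp
  show "\<exists>q. block_subseq e q (s 0) \<and> (\<forall>n. \<exists>m. block_subseq e (tail m q) (s n))"
    if "\<And>n. block_subseq e (s (Suc n)) (s n)" for s
    by (rule block_diagonal) (rule that)
qed

end

section \<open>Coding tuples of block sequences by plays\<close>

text \<open>A play \<open>y\<close> encodes a \<open>k\<close>-tuple of block sequences: the moves at the rounds congruent to \<open>i\<close>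
  modulo \<open>k\<close> belong to the \<open>i\<close>-th sequence, and the digit \<open>\<beta> l\<close> encodes both the \<open>l\<close>-th argument of
  the parametrisation \<open>f\<close> and the list of the rounds whose moves add up to the \<open>l\<close>-th vectors.\<close>

locale coded_tuples = rounding e \<eta> for e :: "nat \<Rightarrow> 'a::real_normed_vector" and \<eta> +
  fixes k :: nat and f :: "(nat \<Rightarrow> nat) \<Rightarrow> nat \<Rightarrow> nat \<Rightarrow> 'a" and \<epsilon> :: "nat \<Rightarrow> real"
  assumes k_pos: "0 < k"
    and \<eta>_small: "finite T \<Longrightarrow> T \<subseteq> {l..} \<Longrightarrow> (\<Sum>m\<in>T. \<eta> m * norm (e m)) \<le> \<epsilon> l"
    and f_continuous: "i < k \<Longrightarrow> 0 < r \<Longrightarrow>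
      \<exists>N. \<forall>\<alpha>'. (\<forall>j<N. \<alpha>' j = \<alpha> j) \<longrightarrow> norm (f \<alpha>' i l - f \<alpha> i l) < r"
begin

definition argument :: "(nat \<Rightarrow> nat) \<Rightarrow> nat \<Rightarrow> nat" where
  "argument \<beta> l = fst (prod_decode (\<beta> l))"

definition rounds :: "nat \<Rightarrow> nat \<Rightarrow> nat set" where
  "rounds i b = {n \<in> set (list_decode (snd (prod_decode b))). n mod k = i}"

definition assembled :: "(nat \<Rightarrow> nat) \<Rightarrow> (nat \<Rightarrow> 'a) \<Rightarrow> nat \<Rightarrow> nat \<Rightarrow> 'a" where
  "assembled \<beta> y i l = (\<Sum>n\<in>rounds i (\<beta> l). y n)"

text \<open>Disjointness of the moves lets rounding commute with the sums in
  \<open>assembled\<close>. The tolerance \<open>\<epsilon> l\<close> pays for rounding a member of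
  the range of \<open>f\<close>; undoing the rounding will cost another
  \<open>\<epsilon> l\<close>.\<close>

definition encodes :: "(nat \<Rightarrow> nat) \<Rightarrow> (nat \<Rightarrow> 'a) \<Rightarrow> bool" where
  "encodes \<beta> y \<longleftrightarrow> (\<forall>m n. m \<noteq> n \<longrightarrow> supp e (y m) \<inter> supp e (y n) = {}) \<and>
     (\<forall>i<k. assembled \<beta> y i \<in> block_seqs e \<and>
       (\<forall>l. norm (assembled \<beta> y i l - f (argument \<beta>) i l) \<le> \<epsilon> l))"

definition payoff :: "nat list \<Rightarrow> (nat \<Rightarrow> 'a) set" where
  "payoff t = {y. \<exists>\<beta>. (\<forall>j<length t. \<beta> j = t ! j) \<and> encodes \<beta> y}"

lemma finite_rounds [simp]: "finite (rounds i b)"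
  unfolding rounds_def by simp

sublocale analytic_game "block_subseq e" tail "\<lambda>p. rounded ` span (range p)" lattice payoff
proof
  show "payoff t \<subseteq> (\<Union>b. payoff (t @ [b]))" for t
  proof
    fix y assume "y \<in> payoff t"
    then obtain \<beta> where \<beta>: "\<forall>j<length t. \<beta> j = t ! j" "encodes \<beta> y" unfolding payoff_def by blast
    then have "\<forall>j<length (t @ [\<beta> (length t)]). \<beta> j = (t @ [\<beta> (length t)]) ! j"
      by (simp add: nth_append less_Suc_eq)
    then show "y \<in> (\<Union>b. payoff (t @ [b]))" using \<beta>(2) unfolding payoff_def by blast
  qed
qed

lemma rounded_block_error:
  assumes "X \<in> block_seqs e"
  shows "norm (rounded (X l) - X l) \<le> \<epsilon> l"
proof -
  have "supp e (X l) \<subseteq> {l..}" using block_supp_ge[OF assms] by blast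
  then show ?thesis
    using rounded_error[OF block_finite[OF assms]] \<eta>_small[OF block_finite[OF assms]] order_trans by blast
qed

lemma block_seqs_cong:
  assumes "\<And>n. supp e (X n) = supp e (Y n)" "X \<in> block_seqs e"
  shows "Y \<in> block_seqs e"
proof -
  have "Y n \<noteq> 0" for n using assms block_nonzero by (metis supp_empty_iff)
  then show ?thesis using assms unfolding block_seqs_iff by simp
qed

text \<open>All clauses are closed: an assembled vector depends on one digit and finitely many
  moves, and \<open>f\<close> is continuous. They therefore pass from the approximating plays and
  parameters to the limit.\<close>

lemma encodes_closed:
  assumes approx: "\<And>j. \<exists>y\<in>payoff (map \<beta> [0..<j]). \<forall>i<j. y i = x i"
  shows "encodes \<beta> x"
proof -
  have ex: "\<exists>\<beta>' y. (\<forall>i<j. \<beta>' i = \<beta> i) \<and> (\<forall>i<j. y i = x i) \<and> encodes \<beta>' y" for j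
    using approx[of j] unfolding payoff_def by auto
  have same: "\<exists>j. \<forall>\<beta>' y. (\<forall>i<j. \<beta>' i = \<beta> i) \<longrightarrow> (\<forall>i<j. y i = x i) \<longrightarrow>
      assembled \<beta>' y i l = assembled \<beta> x i l" for i l
  proof (intro exI allI impI)
    \<comment> \<open>\<open>Suc l\<close> secures the digit \<open>\<beta> l\<close>, the maximum
      secures the rounds that it names, and \<open>insert 0\<close> covers an empty set of
      rounds.\<close>
    let ?j = "max (Suc l) (Suc (Max (insert 0 (rounds i (\<beta> l)))))"
    fix \<beta>' y assume \<beta>': "\<forall>i<?j. \<beta>' i = \<beta> i" and y: "\<forall>i<?j. y i = x i"
    have "n < ?j" if "n \<in> rounds i (\<beta> l)" for n
    proof -
      have "n \<le> Max (insert 0 (rounds i (\<beta> l)))" using that by (intro Max_ge) auto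
      then show ?thesis by linarith
    qed
    then show "assembled \<beta>' y i l = assembled \<beta> x i l"
      unfolding assembled_def using \<beta>' y by (intro sum.cong) auto
  qed
  have disj: "supp e (x m) \<inter> supp e (x n) = {}" if "m \<noteq> n" for m n
  proof -
    obtain \<beta>' y where y: "\<forall>i<max (Suc m) (Suc n). y i = x i" "encodes \<beta>' y" using ex by blast
    then have "supp e (y m) \<inter> supp e (y n) = {}" using that unfolding encodes_def by blast
    then show ?thesis using y(1) by simp
  qed
  have block: "assembled \<beta> x i \<in> block_seqs e" if i: "i < k" for i
    unfolding block_seqs_iff
  proof
    fix l
    obtain j1 j2 where j: "\<forall>\<beta>' y. (\<forall>i<j1. \<beta>' i = \<beta> i) \<longrightarrow> (\<forall>i<j1. y i = x i) \<longrightarrow>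
        assembled \<beta>' y i l = assembled \<beta> x i l"
      "\<forall>\<beta>' y. (\<forall>i<j2. \<beta>' i = \<beta> i) \<longrightarrow> (\<forall>i<j2. y i = x i) \<longrightarrow>
        assembled \<beta>' y i (Suc l) = assembled \<beta> x i (Suc l)" using same by metis
    obtain \<beta>' y where y: "\<forall>i<max j1 j2. \<beta>' i = \<beta> i" "\<forall>i<max j1 j2. y i = x i" "encodes \<beta>' y"
      using ex by blast
    have eq: "assembled \<beta> x i l = assembled \<beta>' y i l"
      by (rule j(1)[rule_format, symmetric]) (use y in auto)
    have eq': "assembled \<beta> x i (Suc l) = assembled \<beta>' y i (Suc l)"
      by (rule j(2)[rule_format, symmetric]) (use y in auto)
    have "assembled \<beta>' y i \<in> block_seqs e" using y(3) i unfolding encodes_def by blast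
    then show "assembled \<beta> x i l \<noteq> 0 \<and> finite (supp e (assembled \<beta> x i l)) \<and>
      (\<forall>a\<in>supp e (assembled \<beta> x i l). \<forall>b\<in>supp e (assembled \<beta> x i (Suc l)). a < b)"
      unfolding eq eq' block_seqs_iff by blast
  qed
  have close: "norm (assembled \<beta> x i l - f (argument \<beta>) i l) \<le> \<epsilon> l" if i: "i < k" for i l
  proof (rule field_le_epsilon)
    fix r :: real assume "0 < r"
    obtain N where N: "\<forall>\<alpha>'. (\<forall>j<N. \<alpha>' j = argument \<beta> j) \<longrightarrow> norm (f \<alpha>' i l - f (argument \<beta>) i l) < r"
      using f_continuous[OF i \<open>0 < r\<close>] by blast
    obtain j1 where j1: "\<forall>\<beta>' y. (\<forall>i<j1. \<beta>' i = \<beta> i) \<longrightarrow> (\<forall>i<j1. y i = x i) \<longrightarrow>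
        assembled \<beta>' y i l = assembled \<beta> x i l" using same by metis
    obtain \<beta>' y where y: "\<forall>i<max j1 N. \<beta>' i = \<beta> i" "\<forall>i<max j1 N. y i = x i" "encodes \<beta>' y"
      using ex by blast
    have eq: "assembled \<beta> x i l = assembled \<beta>' y i l"
      by (rule j1[rule_format, symmetric]) (use y in auto)
    have "norm (f (argument \<beta>') i l - f (argument \<beta>) i l) < r"
      by (rule N[rule_format]) (use y(1) in \<open>simp add: argument_def\<close>)
    moreover have "norm (assembled \<beta>' y i l - f (argument \<beta>') i l) \<le> \<epsilon> l"
      using y(3) i unfolding encodes_def by blast
    ultimately show "norm (assembled \<beta> x i l - f (argument \<beta>) i l) \<le> \<epsilon> l + r"
      unfolding eq using norm_triangle_ineq[of "assembled \<beta>' y i l - f (argument \<beta>') i l"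
          "f (argument \<beta>') i l - f (argument \<beta>) i l"] by simp
  qed
  show ?thesis unfolding encodes_def using disj block close by blast
qed

text \<open>Each move is traced back to a vector of the span that rounds to it. These vectors are
  disjointly supported like the moves, so by \<open>rounded_sum\<close> their sums round to the
  assembled vectors and have the same supports.\<close>

lemma decode_play:
  assumes U: "\<And>i. i < k \<Longrightarrow> U i \<in> block_seqs e"
    and x: "\<And>n. x n \<in> rounded ` span (range (U (n mod k)))"
    and "encodes \<beta> x"
  shows "\<exists>V. \<forall>i<k. block_subseq e (V i) (U i) \<and>
    (\<forall>l. norm (V i l - f (argument \<beta>) i l) \<le> 2 * \<epsilon> l)"
proof -
  have "\<forall>n. \<exists>v. v \<in> span (range (U (n mod k))) \<and> x n = rounded v" using x by blast
  from choice[OF this] obtain w where w: "\<And>n. w n \<in> span (range (U (n mod k)))" "\<And>n. x n = rounded (w n)" by blast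
  have fin: "finite (supp e (w n))" for n using span_finite_supp[OF U w(1)] k_pos by simp
  have disj: "supp e (w m) \<inter> supp e (w n) = {}" if "m \<noteq> n" for m n
    using assms(3) that w(2) fin unfolding encodes_def by (metis supp_rounded)
  define V where "V = assembled \<beta> w"
  have "block_subseq e (V i) (U i) \<and> (\<forall>l. norm (V i l - f (argument \<beta>) i l) \<le> 2 * \<epsilon> l)" if i: "i < k" for i
  proof -
    have span: "V i l \<in> span (range (U i))" for l
      unfolding V_def assembled_def by (intro span_sum) (use w(1) in \<open>auto simp: rounds_def\<close>)
    have eq: "assembled \<beta> x i l = rounded (V i l)" for l
      unfolding V_def assembled_def w(2) by (rule rounded_sum[symmetric]) (use fin disj in auto)
    have "assembled \<beta> x i \<in> block_seqs e" using assms(3) i unfolding encodes_def by blast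
    then have V: "V i \<in> block_seqs e"
      by (rule block_seqs_cong[rotated]) (use eq span_finite_supp[OF U[OF i] span] in simp)
    have "norm (V i l - f (argument \<beta>) i l) \<le> 2 * \<epsilon> l" for l
    proof -
      have "norm (V i l - f (argument \<beta>) i l) \<le> norm (V i l - rounded (V i l)) + norm (rounded (V i l) - f (argument \<beta>) i l)"
        using norm_triangle_ineq[of "V i l - rounded (V i l)" "rounded (V i l) - f (argument \<beta>) i l"] by simp
      moreover have "norm (rounded (V i l) - f (argument \<beta>) i l) \<le> \<epsilon> l"
        using assms(3) i eq unfolding encodes_def by metis
      ultimately show ?thesis using rounded_block_error[OF V, of l] by (simp add: norm_minus_commute)
    qed
    then show ?thesis unfolding block_subseq_def using V U[OF i] span by blast
  qed
  then show ?thesis by blast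
qed

section \<open>Playing disjointly supported tuples against a strategy of I\<close>

text \<open>Rounded vectors of bounded support and bounded coordinates form a finite set, so only finitely
  many plays have to be taken into account when \<open>g j\<close> is chosen.\<close>

lemma outrunning_subsequence:
  assumes q: "q \<in> block_seqs e" and B: "\<And>m. 0 \<le> B m"
  obtains g where "strict_mono g"
    "\<And>j u. set u \<subseteq> {rounded w | w. supp e w \<subseteq> (\<Union>i<j. supp e (q (g i))) \<and> (\<forall>m. \<bar>coords e w m\<bar> \<le> B m)} \<Longrightarrow>
      length u < Suc j * k \<Longrightarrow> \<sigma> u \<le> g j"
proof -
  define E where "E M = {rounded w | w. supp e w \<subseteq> {..<M} \<and> (\<forall>m. \<bar>coords e w m\<bar> \<le> B m)}" for M
  define \<phi> where "\<phi> M = Max (\<sigma> ` {u. set u \<subseteq> E M \<and> length u \<le> M})" for M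
  have \<phi>: "\<sigma> u \<le> \<phi> M" if "set u \<subseteq> E M" "length u \<le> M" for u M
    unfolding \<phi>_def using that finite_lists_length_le[of "E M" M] finite_bounded_rounded
    by (intro Max_ge) (auto simp: E_def)
  \<comment> \<open>For \<open>j = Suc i\<close>, the number \<open>M (g i)\<close> exceeds all
    positions in \<open>q (g 0)\<close>, ..., \<open>q (g i)\<close>. It also bounds the length of
    the play, which is below \<open>(i + 2) * k\<close>, because \<open>i \<le> g i\<close>.\<close>
  define M where "M n = Suc (Max (supp e (q n))) + (n + 2) * k" for n
  \<comment> \<open>For \<open>j = 0\<close> the plays consist of fewer than \<open>k\<close> zero
    moves, whence the initial value \<open>\<phi> k\<close>.\<close>
  define g where "g = rec_nat (\<phi> k) (\<lambda>_ n. max (Suc n) (\<phi> (M n)))"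
  have g0: "g 0 = \<phi> k" and gS: "g (Suc j) = max (Suc (g j)) (\<phi> (M (g j)))" for j
    unfolding g_def by simp_all
  have mono: "strict_mono g" unfolding strict_mono_Suc_iff by (simp add: gS less_max_iff_disj)
  moreover have "\<sigma> u \<le> g j"
    if u: "set u \<subseteq> {rounded w | w. supp e w \<subseteq> (\<Union>i<j. supp e (q (g i))) \<and> (\<forall>m. \<bar>coords e w m\<bar> \<le> B m)}"
      and len: "length u < Suc j * k" for j u
  proof (cases j)
    case 0
    have "set u \<subseteq> E k" using u unfolding E_def 0 by fastforce
    then show ?thesis using \<phi>[of u k] len unfolding 0 g0 by simp
  next
    case (Suc i)
    have "supp e (q (g i')) \<subseteq> {..<M (g i)}" if "i' < j" for i'
    proof
      fix a assume a: "a \<in> supp e (q (g i'))"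
      have "a \<le> Max (supp e (q (g i)))"
      proof (cases "i' = i")
        case True
        then show ?thesis using a block_finite[OF q] by simp
      next
        case False
        then have "g i' < g i" using that Suc strict_monoD[OF mono] by simp
        moreover have "Max (supp e (q (g i))) \<in> supp e (q (g i))"
          using block_finite[OF q] block_nonzero[OF q] by (intro Max_in) auto
        ultimately show ?thesis using block_less[OF q _ a] less_imp_le by blast
      qed
      then show "a \<in> {..<M (g i)}" unfolding M_def by simp
    qed
    then have "set u \<subseteq> E (M (g i))" using u unfolding E_def by blast
    moreover have "length u \<le> M (g i)"
    proof -
      have "length u \<le> (i + 2) * k" using len Suc by simp
      also have "\<dots> \<le> (g i + 2) * k" using strict_mono_imp_increasing[OF mono, of i] by simp
      finally show ?thesis unfolding M_def by simp
    qed
    ultimately show ?thesis using \<phi>[of u "M (g i)"] unfolding Suc gS by simp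
  qed
  ultimately show ?thesis using that by blast
qed

end

context coded_tuples
begin

text \<open>Disjointness of the supports of the \<open>W i\<close> enters here: for each \<open>j\<close> at most one of the \<open>k\<close>
  rounds \<open>n\<close> with \<open>n div k = j\<close> carries a nonzero move, so that I's answers to the moves made
  before it do not depend on \<open>z j\<close>.\<close>

lemma encode_tuple:
  assumes z: "z \<in> block_seqs e"
    and W: "\<And>i. i < k \<Longrightarrow> block_subseq e (W i) z"
    and disj: "\<And>i j. i < k \<Longrightarrow> j < k \<Longrightarrow> i \<noteq> j \<Longrightarrow> disjointly_supported e (W i) (W j)"
    and W_eq: "\<And>i. i < k \<Longrightarrow> W i = f \<alpha> i"
    and bound: "\<And>i l m. i < k \<Longrightarrow> \<bar>coords e (W i l) m\<bar> \<le> B m"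
  obtains v where "(\<lambda>n. rounded (v n)) \<in> payoff []"
    "\<And>n. v n \<in> span {z (n div k)}" "\<And>n. supp e (v n) \<subseteq> supp e (z (n div k))"
    "\<And>m n. v m \<noteq> 0 \<Longrightarrow> v n \<noteq> 0 \<Longrightarrow> m div k = n div k \<Longrightarrow> m = n"
    "\<And>n m. \<bar>coords e (v n) m\<bar> \<le> B m"
proof -
  have B: "0 \<le> B m" for m using bound[OF k_pos, of 0 m] by linarith
  have Wb: "W i \<in> block_seqs e" and Wz: "W i l \<in> span (range z)" if "i < k" for i l
    using W[OF that] unfolding block_subseq_def by auto
  have finW: "finite (supp e (W i l))" if "i < k" for i l using block_finite[OF Wb[OF that]] .
  have finz: "finite (supp e (z j))" for j using block_finite[OF z] .
  have nez: "\<exists>m. m \<in> supp e (z j)" for j using block_nonzero[OF z] supp_empty_iff by blast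
  define inside where "inside i j l \<longleftrightarrow> supp e (z j) \<subseteq> supp e (W i l)" for i j l
  have inside_unique: "l = l'" if "i < k" "inside i j l" "inside i j l'" for i j l l'
    using nez[of j] that(2,3) block_disjoint[OF Wb[OF that(1)]] unfolding inside_def by blast
  have inside_disj: "i = i'" if "i < k" "i' < k" "inside i j l" "inside i' j l'" for i i' j l l'
  proof (rule ccontr)
    assume "i \<noteq> i'"
    from disj[OF that(1,2) this] have "supp e (W i l) \<inter> supp e (W i' l') = {}"
      unfolding disjointly_supported_def by blast
    then show False using nez[of j] that(3,4) unfolding inside_def by blast
  qed
  \<comment> \<open>Round \<open>j * k + i\<close> plays the part on \<open>z j\<close> of the term
    of \<open>W i\<close> whose support contains this block, and 0 if there is none.\<close>
  define v where "v n = (if \<exists>l. inside (n mod k) (n div k) l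
      then proj (supp e (z (n div k))) (W (n mod k) (THE l. inside (n mod k) (n div k) l)) else 0)" for n
  have mod: "n mod k < k" for n using k_pos by simp
  have v: "v n = proj (supp e (z (n div k))) (W (n mod k) l)" if "inside (n mod k) (n div k) l" for n l
  proof -
    have l: "(THE l. inside (n mod k) (n div k) l) = l"
      by (rule the_equality) (use that inside_unique[OF mod] in blast)+
    have ex: "\<exists>l. inside (n mod k) (n div k) l" using that by blast
    show ?thesis by (simp only: v_def if_P[OF ex] l)
  qed
  have v0: "v n = 0" if "\<nexists>l. inside (n mod k) (n div k) l" for n by (simp only: v_def if_not_P[OF that])
  have supp_v: "supp e (v n) \<subseteq> supp e (z (n div k))" for n
  proof (cases "\<exists>l. inside (n mod k) (n div k) l")
    case True
    then show ?thesis using v supp_proj[OF finz] by auto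
  next
    case False
    then show ?thesis using v0 by (simp add: supp_def)
  qed
  have span_v: "v n \<in> span {z (n div k)}" for n
  proof (cases "\<exists>l. inside (n mod k) (n div k) l")
    case True
    then show ?thesis using v span_block_supp(3)[OF z Wz[OF mod]] by auto
  next
    case False
    then show ?thesis using v0 span_zero by auto
  qed
  have bound_v: "\<bar>coords e (v n) m\<bar> \<le> B m" for n m
  proof (cases "\<exists>l. inside (n mod k) (n div k) l")
    case True
    then show ?thesis using v bound[OF mod] B coords_proj[OF finz] by auto
  next
    case False
    then show ?thesis using v0 B by auto
  qed
  have fin_v: "finite (supp e (v n))" for n using supp_v finz finite_subset by blast
  have unique: "m = n" if "v m \<noteq> 0" "v n \<noteq> 0" "m div k = n div k" for m n
  proof -
    have "\<exists>l. inside (m mod k) (m div k) l" "\<exists>l. inside (n mod k) (n div k) l"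
      using v0[of m] v0[of n] that(1,2) by blast+
    then have "m mod k = n mod k" using inside_disj[OF mod mod] that(3) by auto
    then show ?thesis using that(3) by (metis div_mult_mod_eq)
  qed
  have disj_v: "supp e (v m) \<inter> supp e (v n) = {}" if "m \<noteq> n" for m n
  proof (rule ccontr)
    assume "supp e (v m) \<inter> supp e (v n) \<noteq> {}"
    then obtain a where a: "a \<in> supp e (v m)" "a \<in> supp e (v n)" by blast
    then have "m div k = n div k" using supp_v block_disjoint[OF z] by blast
    moreover have "v m \<noteq> 0" "v n \<noteq> 0" using a supp_empty_iff by blast+
    ultimately show False using unique that by blast
  qed
  define J where "J i l = {j. inside i j l}" for i l
  have finJ: "finite (J i l)" if "i < k" for i l
  proof -
    have "J i l \<subseteq> {..Max (supp e (W i l))}"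
    proof
      fix j assume "j \<in> J i l"
      moreover obtain m where m: "m \<in> supp e (z j)" using nez by blast
      ultimately have "m \<in> supp e (W i l)" unfolding J_def inside_def by blast
      then have "m \<le> Max (supp e (W i l))" using finW[OF that] by simp
      then show "j \<in> {..Max (supp e (W i l))}" using block_supp_ge[OF z m] by simp
    qed
    then show ?thesis using finite_subset by blast
  qed
  define S where "S i l = (\<lambda>j. j * k + i) ` J i l" for i l
  \<comment> \<open>One list names the rounds of all \<open>k\<close> sequences;
    \<open>rounds\<close> separates them by their residues modulo \<open>k\<close>.\<close>
  define \<beta> where "\<beta> l = prod_encode (\<alpha> l, list_encode (sorted_list_of_set (\<Union>i<k. S i l)))" for l
  have \<alpha>: "argument \<beta> = \<alpha>" unfolding argument_def \<beta>_def by simp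
  have S: "rounds i (\<beta> l) = S i l" if "i < k" for i l
  proof -
    have "finite (\<Union>i<k. S i l)" unfolding S_def using finJ by simp
    then have "rounds i (\<beta> l) = {n \<in> (\<Union>i<k. S i l). n mod k = i}" unfolding rounds_def \<beta>_def by simp
    also have "\<dots> = S i l" using that unfolding S_def by auto
    finally show ?thesis .
  qed
  have sum: "assembled \<beta> (\<lambda>n. rounded (v n)) i l = rounded (W i l)" if i: "i < k" for i l
  proof -
    have inj: "inj_on (\<lambda>j. j * k + i) (J i l)" using k_pos by (auto simp: inj_on_def)
    have "(\<Sum>n\<in>S i l. v n) = (\<Sum>j\<in>J i l. v (j * k + i))"
      unfolding S_def sum.reindex[OF inj] by simp
    also have "\<dots> = (\<Sum>j\<in>J i l. proj (supp e (z j)) (W i l))"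
    proof (rule sum.cong[OF refl])
      fix j assume "j \<in> J i l"
      moreover have "(j * k + i) div k = j" "(j * k + i) mod k = i" using i by auto
      ultimately show "v (j * k + i) = proj (supp e (z j)) (W i l)"
        using v[of "j * k + i" l] unfolding J_def by simp
    qed
    also have "\<dots> = (\<Sum>m\<in>(\<Union>j\<in>J i l. supp e (z j)). coords e (W i l) m *\<^sub>R e m)"
      unfolding proj_def using finJ[OF i] finz block_disjoint[OF z]
      by (intro sum.UNION_disjoint[symmetric]) blast+
    also have "(\<Union>j\<in>J i l. supp e (z j)) = supp e (W i l)"
      using span_block_supp(1)[OF z Wz[OF i]] unfolding J_def inside_def by blast
    also have "(\<Sum>m\<in>supp e (W i l). coords e (W i l) m *\<^sub>R e m) = W i l"
      using finite_expansion[OF finW[OF i] subset_refl] by simp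
    finally have W: "(\<Sum>n\<in>S i l. v n) = W i l" .
    have "finite (S i l)" unfolding S_def using finJ[OF i] by simp
    then have "rounded (\<Sum>n\<in>S i l. v n) = (\<Sum>n\<in>S i l. rounded (v n))"
      by (rule rounded_sum) (use fin_v disj_v in blast)+
    then show ?thesis unfolding assembled_def S[OF i] W by simp
  qed
  have "encodes \<beta> (\<lambda>n. rounded (v n))"
    unfolding encodes_def
  proof (intro conjI allI impI)
    show "supp e (rounded (v m)) \<inter> supp e (rounded (v n)) = {}" if "m \<noteq> n" for m n
      using disj_v[OF that] fin_v by simp
    fix i assume i: "i < k"
    show "assembled \<beta> (\<lambda>n. rounded (v n)) i \<in> block_seqs e"
      by (rule block_seqs_cong[OF _ Wb[OF i]]) (simp add: sum[OF i] finW[OF i])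
    show "norm (assembled \<beta> (\<lambda>n. rounded (v n)) i l - f (argument \<beta>) i l) \<le> \<epsilon> l" for l
      using rounded_block_error[OF Wb[OF i], of l] by (simp add: sum[OF i] \<alpha> W_eq[OF i, symmetric])
  qed
  then have "(\<lambda>n. rounded (v n)) \<in> payoff []" unfolding payoff_def by auto
  then show ?thesis using that span_v supp_v unique bound_v by blast
qed

text \<open>A disjointly supported tuple in the range of \<open>f\<close> would yield, by
  \<open>encode_tuple\<close>, a play in \<open>payoff []\<close>. Since \<open>z\<close> outruns
  every tail that \<open>\<sigma>\<close> can demand, this play obeys \<open>\<sigma>\<close>, which
  contradicts \<open>avoids\<close>.\<close>

lemma avoiding_strategy:
  assumes q: "q \<in> block_seqs e" and \<sigma>: "avoids q [] [] \<sigma>"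
  shows "\<exists>z\<in>block_seqs e. \<forall>W\<in>perp_tuples e k (ball_block_subseqs e z). \<forall>\<alpha>. \<exists>i<k. W i \<noteq> f \<alpha> i"
proof -
  obtain C where C: "\<And>x m. \<bar>coords e x m\<bar> * norm (e m) \<le> C * norm x" using coords_bound by blast
  define B where "B m = \<bar>C\<bar> / norm (e m)" for m
  have B: "\<bar>coords e x m\<bar> \<le> B m" if "norm x \<le> 1" for x m
  proof -
    have "\<bar>coords e x m\<bar> * norm (e m) \<le> C * norm x" by (rule C)
    also have "\<dots> \<le> \<bar>C\<bar> * norm x" by (simp add: mult_right_mono)
    also have "\<dots> \<le> \<bar>C\<bar>" using mult_left_mono[OF that, of "\<bar>C\<bar>"] by simp
    finally show ?thesis unfolding B_def by (simp add: pos_le_divide_eq)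
  qed
  have B0: "0 \<le> B m" for m unfolding B_def by simp
  obtain g where g: "strict_mono g"
    "\<And>j u. set u \<subseteq> {rounded w | w. supp e w \<subseteq> (\<Union>i<j. supp e (q (g i))) \<and> (\<forall>m. \<bar>coords e w m\<bar> \<le> B m)} \<Longrightarrow>
      length u < Suc j * k \<Longrightarrow> \<sigma> u \<le> g j"
    by (rule outrunning_subsequence[OF q, where B = B and \<sigma> = \<sigma>, OF B0]) (rule that)
  define z where "z j = q (g j)" for j
  have z: "z \<in> block_seqs e" unfolding z_def by (rule block_subsequence[OF q g(1)])
  have "\<exists>i<k. W i \<noteq> f \<alpha> i" if W: "W \<in> perp_tuples e k (ball_block_subseqs e z)" for W \<alpha>
  proof (rule ccontr)
    assume "\<not> (\<exists>i<k. W i \<noteq> f \<alpha> i)"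
    then have W_eq: "\<And>i. i < k \<Longrightarrow> W i = f \<alpha> i" by blast
    have Wi: "W i \<in> ball_block_subseqs e z" if "i < k" for i
      using W that unfolding perp_tuples_def by auto
    obtain v where v: "(\<lambda>n. rounded (v n)) \<in> payoff []"
      "\<And>n. v n \<in> span {z (n div k)}" "\<And>n. supp e (v n) \<subseteq> supp e (z (n div k))"
      "\<And>m n. v m \<noteq> 0 \<Longrightarrow> v n \<noteq> 0 \<Longrightarrow> m div k = n div k \<Longrightarrow> m = n"
      "\<And>n m. \<bar>coords e (v n) m\<bar> \<le> B m"
    proof (rule encode_tuple[OF z _ _ W_eq, of B])
      show "block_subseq e (W i) z" if "i < k" for i
        using Wi[OF that] unfolding ball_block_subseqs_def by blast
      show "disjointly_supported e (W i) (W j)" if "i < k" "j < k" "i \<noteq> j" for i j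
        using W that unfolding perp_tuples_def by blast
      show "\<bar>coords e (W i l) m\<bar> \<le> B m" if "i < k" for i l m
        using Wi[OF that] by (intro B) (simp add: ball_block_subseqs_def)
    qed blast+
    define y where "y n = rounded (v n)" for n
    have "y n \<in> rounded ` span (range (tail (\<sigma> (map y [0..<n])) q))" for n
    \<comment> \<open>A zero move is legal in every tail, so the growth of \<open>g\<close> matters
      only at nonzero moves.\<close>
    proof (cases "v n = 0")
      case True
      then show ?thesis unfolding y_def using span_zero by (metis imageI)
    next
      case False
      define j where "j = n div k"
      have "supp e (v m) \<subseteq> (\<Union>i<j. supp e (q (g i)))" if "m < n" for m
      proof (cases "m div k = j")
        case True
        \<comment> \<open>The other rounds belonging to the block \<open>z j\<close> carry 0, so the
          play before round \<open>n\<close> involves only the blocks preceding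
          \<open>z j\<close>.\<close>
        then have "v m = 0" using v(4)[OF _ False, of m] that unfolding j_def by blast
        then show ?thesis by (simp add: supp_def)
      next
        case False
        have "m div k \<le> j" unfolding j_def using that by (simp add: div_le_mono)
        then have "m div k < j" using False by simp
        then show ?thesis using v(3)[of m] unfolding z_def by blast
      qed
      then have vm: "supp e (v m) \<subseteq> (\<Union>i<j. supp e (q (g i))) \<and> (\<forall>a. \<bar>coords e (v m) a\<bar> \<le> B a)"
        if "m < n" for m using that v(5) by blast
      have "set (map y [0..<n]) \<subseteq>
          {rounded w | w. supp e w \<subseteq> (\<Union>i<j. supp e (q (g i))) \<and> (\<forall>m. \<bar>coords e w m\<bar> \<le> B m)}"
      proof
        fix w assume "w \<in> set (map y [0..<n])"
        then obtain m where "m < n" "w = rounded (v m)" unfolding y_def by auto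
        then show "w \<in> {rounded w | w. supp e w \<subseteq> (\<Union>i<j. supp e (q (g i))) \<and> (\<forall>m. \<bar>coords e w m\<bar> \<le> B m)}"
          using vm by blast
      qed
      moreover have "length (map y [0..<n]) < Suc j * k"
        unfolding j_def using dividend_less_div_times[OF k_pos, of n] by simp
      ultimately have "\<sigma> (map y [0..<n]) \<le> g j" by (rule g(2))
      then have "z j \<in> range (tail (\<sigma> (map y [0..<n])) q)"
        unfolding z_def tail_def by (intro image_eqI[of _ _ "g j - \<sigma> (map y [0..<n])"]) auto
      then have "span {z j} \<subseteq> span (range (tail (\<sigma> (map y [0..<n])) q))" by (intro span_mono) blast
      then show ?thesis using v(2)[of n] unfolding y_def j_def by blast
    qed
    then have "y \<notin> payoff []" using \<sigma> unfolding avoids_def by simp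
    then show False using v(1) unfolding y_def by simp
  qed
  then show ?thesis using z by blast
qed

lemma coded_dichotomy:
  "\<exists>Y\<in>block_seqs e.
     (\<forall>W\<in>perp_tuples e k (ball_block_subseqs e Y). \<forall>\<alpha>. \<exists>i<k. W i \<noteq> f \<alpha> i) \<or>
     (\<forall>U. (\<forall>i<k. block_subseq e (U i) Y) \<longrightarrow> (\<exists>V \<alpha>. \<forall>i<k. block_subseq e (V i) (U i) \<and>
        (\<forall>l. norm (V i l - f \<alpha> i l) \<le> 2 * \<epsilon> l)))"
proof -
  obtain q where q: "block_subseq e q e"
    and dich: "(\<exists>\<sigma>. avoids q [] [] \<sigma>) \<or> (\<forall>Q. (\<forall>n. block_subseq e (Q n) q) \<longrightarrow>
      (\<exists>x \<beta>. (\<forall>n. x n \<in> rounded ` span (range (Q n))) \<and>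
        (\<forall>j. \<exists>y\<in>payoff (map \<beta> [0..<j]). \<forall>i<j. y i = x i)))"
    using asymptotic_dichotomy[OF block_subseq_refl[OF basis_block]] by blast
  have qb: "q \<in> block_seqs e" using q unfolding block_subseq_def by blast
  from dich show ?thesis
  proof
    assume "\<exists>\<sigma>. avoids q [] [] \<sigma>"
    then show ?thesis using avoiding_strategy[OF qb] by blast
  next
    assume *: "\<forall>Q. (\<forall>n. block_subseq e (Q n) q) \<longrightarrow>
      (\<exists>x \<beta>. (\<forall>n. x n \<in> rounded ` span (range (Q n))) \<and>
        (\<forall>j. \<exists>y\<in>payoff (map \<beta> [0..<j]). \<forall>i<j. y i = x i))"
    have "\<exists>V \<alpha>. \<forall>i<k. block_subseq e (V i) (U i) \<and> (\<forall>l. norm (V i l - f \<alpha> i l) \<le> 2 * \<epsilon> l)"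
      if U: "\<forall>i<k. block_subseq e (U i) q" for U
    proof -
      have "\<forall>n. block_subseq e (U (n mod k)) q" using U k_pos by simp
      from *[rule_format, of "\<lambda>n. U (n mod k)", OF this[rule_format]]
      obtain x \<beta> where x: "\<And>n. x n \<in> rounded ` span (range (U (n mod k)))"
        and \<beta>: "\<And>j. \<exists>y\<in>payoff (map \<beta> [0..<j]). \<forall>i<j. y i = x i" by blast
      have "encodes \<beta> x" using \<beta> by (rule encodes_closed)
      from decode_play[OF _ x this] U show ?thesis unfolding block_subseq_def by blast
    qed
    then show ?thesis using qb by blast
  qed
qed

end

section \<open>Choice of the mesh, continuity on the Baire space, and the theorem\<close>

text \<open>The minimum over all indices up to \<open>m\<close> lets one mesh serve every
  \<open>l \<le> m\<close>; the factor \<open>(1/2) ^ Suc m\<close> bounds the sums by a geometric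
  series.\<close>

lemma (in schauder) small_mesh:
  assumes "\<And>n. (0::real) < \<epsilon> n"
  obtains \<eta> :: "nat \<Rightarrow> real" where "\<And>m. 0 < \<eta> m"
    "\<And>T l. finite T \<Longrightarrow> T \<subseteq> {l..} \<Longrightarrow> (\<Sum>m\<in>T. \<eta> m * norm (e m)) \<le> \<epsilon> l"
proof -
  define \<eta> where "\<eta> m = Min (\<epsilon> ` {..m}) * (1/2) ^ Suc m / norm (e m)" for m
  have pos: "0 < Min (\<epsilon> ` {..m})" for m using assms by (subst Min_gr_iff) auto
  have "0 < \<eta> m" for m unfolding \<eta>_def using pos by simp
  moreover have "(\<Sum>m\<in>T. \<eta> m * norm (e m)) \<le> \<epsilon> l" if T: "finite T" "T \<subseteq> {l..}" for T l
  proof -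
    have "(\<Sum>m\<in>T. \<eta> m * norm (e m)) \<le> (\<Sum>m\<in>T. \<epsilon> l * (1/2) ^ Suc m)"
    proof (rule sum_mono)
      fix m assume "m \<in> T"
      then have "Min (\<epsilon> ` {..m}) \<le> \<epsilon> l" using T by (intro Min_le) auto
      then show "\<eta> m * norm (e m) \<le> \<epsilon> l * (1/2) ^ Suc m"
        unfolding \<eta>_def by (simp add: mult_right_mono)
    qed
    also have "\<dots> = \<epsilon> l * (\<Sum>m\<in>T. (1/2) ^ Suc m)" by (simp add: sum_distrib_left)
    also have "\<dots> \<le> \<epsilon> l * 1"
    proof (rule mult_left_mono)
      show "(\<Sum>m\<in>T. (1/2) ^ Suc m) \<le> (1::real)"
        using sum_le_suminf[OF sums_summable[OF power_half_series] T(1)] sums_unique[OF power_half_series]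
        by simp
    qed (use assms less_imp_le in blast)
    finally show ?thesis by simp
  qed
  ultimately show ?thesis using that by blast
qed

text \<open>A basic neighbourhood of \<alpha> restricts only finitely many coordinates, and
  \<open>N\<close> is chosen beyond them.\<close>

lemma continuous_map_baire_space:
  assumes "continuous_map baire_space (euclidean :: 'b::real_normed_vector topology) h" and "0 < r"
  shows "\<exists>N. \<forall>\<alpha>'. (\<forall>j<N. \<alpha>' j = \<alpha> j) \<longrightarrow> norm (h \<alpha>' - h \<alpha>) < r"
proof -
  have "openin baire_space {x \<in> topspace baire_space. h x \<in> ball (h \<alpha>) r}"
    using assms(1) by (rule openin_continuous_map_preimage) simp
  moreover have "topspace baire_space = UNIV" unfolding baire_space_def by simp
  ultimately have "openin baire_space {x. h x \<in> ball (h \<alpha>) r}" by simp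
  then have "\<exists>X. finite {i. X i \<noteq> UNIV} \<and> \<alpha> \<in> Pi\<^sub>E UNIV X \<and> Pi\<^sub>E UNIV X \<subseteq> {x. h x \<in> ball (h \<alpha>) r}"
    using assms(2) unfolding baire_space_def openin_product_topology_alt by simp
  then obtain X where X: "\<alpha> \<in> Pi\<^sub>E UNIV X" "finite {i. X i \<noteq> UNIV}"
    "Pi\<^sub>E UNIV X \<subseteq> {x. h x \<in> ball (h \<alpha>) r}"
    by blast
  show ?thesis
  proof (intro exI allI impI)
    fix \<alpha>' assume \<alpha>': "\<forall>j<Suc (Max (insert 0 {i. X i \<noteq> UNIV})). \<alpha>' j = \<alpha> j"
    have "\<alpha>' i \<in> X i" for i
    proof (cases "X i = UNIV")
      case False
      then have "i \<le> Max (insert 0 {i. X i \<noteq> UNIV})" using X(2) by (intro Max_ge) auto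
      then have "\<alpha>' i = \<alpha> i" using \<alpha>' by (simp only: less_Suc_eq_le)
      then show ?thesis using X(1) by (simp add: PiE_iff)
    qed simp
    then have "\<alpha>' \<in> Pi\<^sub>E UNIV X" by (simp add: PiE_iff)
    then show "norm (h \<alpha>' - h \<alpha>) < r" using X(3) by (auto simp: dist_norm norm_minus_commute)
  qed
qed

theorem theorem2:
  fixes e :: "nat \<Rightarrow> 'a::real_normed_vector"
    and k :: nat
    and F :: "(nat \<Rightarrow> nat \<Rightarrow> 'a) set"
  assumes "schauder_basis e"
    and "k \<ge> 2"
    and "F \<subseteq> tuples k (ball_block_seqs e)"
    and "analytic_in (product_topology (\<lambda>_. ball_block_topology e) {..<k}) F"
  shows "\<forall>\<delta> :: nat \<Rightarrow> real. (\<forall>n. \<delta> n > 0) \<longrightarrow>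
    (\<exists>Y \<in> block_seqs e.
       perp_tuples e k (ball_block_subseqs e Y) \<inter> F = {} \<or>
       tuples k (ball_block_subseqs e Y) \<subseteq> upward e k (expansion e k \<delta> F))"
proof (intro allI impI)
  fix \<delta> :: "nat \<Rightarrow> real" assume \<delta>: "\<forall>n. \<delta> n > 0"
  interpret schauder e by unfold_locales (rule assms(1))
  show "\<exists>Y \<in> block_seqs e.
       perp_tuples e k (ball_block_subseqs e Y) \<inter> F = {} \<or>
       tuples k (ball_block_subseqs e Y) \<subseteq> upward e k (expansion e k \<delta> F)"
  proof (cases "F = {}")
    case True
    then show ?thesis using basis_block by blast
  next
    case False
    then obtain f where f: "continuous_map baire_space (product_topology (\<lambda>_. ball_block_topology e) {..<k}) f"
      "f ` topspace baire_space = F" using assms(4) unfolding analytic_in_def by blast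
    have top: "topspace baire_space = UNIV" unfolding baire_space_def by simp
    have F: "F = range f" using f(2) top by simp
    have cont: "continuous_map baire_space euclidean (\<lambda>\<alpha>. f \<alpha> i l)" if "i < k" for i l
    proof -
      have "continuous_map baire_space (ball_block_topology e) (\<lambda>\<alpha>. f \<alpha> i)"
        using f(1) that unfolding continuous_map_componentwise by auto
      then have "continuous_map baire_space (product_topology (\<lambda>_. euclidean) UNIV) (\<lambda>\<alpha>. f \<alpha> i)"
        unfolding ball_block_topology_def continuous_map_in_subtopology by blast
      then show ?thesis unfolding continuous_map_componentwise by auto
    qed
    \<comment> \<open>Half of \<open>\<delta> l\<close>, because \<open>decode_play\<close> loses
      the tolerance twice.\<close>
    obtain \<eta> where \<eta>: "\<And>m. 0 < \<eta> m"
      "\<And>T l. finite T \<Longrightarrow> T \<subseteq> {l..} \<Longrightarrow> (\<Sum>m\<in>T. \<eta> m * norm (e m)) \<le> \<delta> l / 2"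
      by (rule small_mesh[of "\<lambda>l. \<delta> l / 2"]) (use \<delta> in auto)
    interpret coded_tuples e \<eta> k f "\<lambda>l. \<delta> l / 2"
    proof unfold_locales
      show "\<exists>N. \<forall>\<alpha>'. (\<forall>j<N. \<alpha>' j = \<alpha> j) \<longrightarrow> norm (f \<alpha>' i l - f \<alpha> i l) < r"
        if "i < k" "0 < r" for i r l \<alpha>
        by (rule continuous_map_baire_space[OF cont[OF that(1)] that(2)])
    qed (use \<eta> \<delta> assms(2) in auto)
    from coded_dichotomy obtain Y where Y: "Y \<in> block_seqs e"
      and dich: "(\<forall>W\<in>perp_tuples e k (ball_block_subseqs e Y). \<forall>\<alpha>. \<exists>i<k. W i \<noteq> f \<alpha> i) \<or>
        (\<forall>U. (\<forall>i<k. block_subseq e (U i) Y) \<longrightarrow> (\<exists>V \<alpha>. \<forall>i<k. block_subseq e (V i) (U i) \<and>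
           (\<forall>l. norm (V i l - f \<alpha> i l) \<le> \<delta> l)))" by auto
    from dich have "perp_tuples e k (ball_block_subseqs e Y) \<inter> F = {} \<or>
       tuples k (ball_block_subseqs e Y) \<subseteq> upward e k (expansion e k \<delta> F)"
    proof
      assume "\<forall>W\<in>perp_tuples e k (ball_block_subseqs e Y). \<forall>\<alpha>. \<exists>i<k. W i \<noteq> f \<alpha> i"
      then show ?thesis unfolding F by blast
    next
      assume *: "\<forall>U. (\<forall>i<k. block_subseq e (U i) Y) \<longrightarrow> (\<exists>V \<alpha>. \<forall>i<k. block_subseq e (V i) (U i) \<and>
           (\<forall>l. norm (V i l - f \<alpha> i l) \<le> \<delta> l))"
      have "U \<in> upward e k (expansion e k \<delta> F)" if U: "U \<in> tuples k (ball_block_subseqs e Y)" for U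
      proof -
        have UY: "\<forall>i<k. block_subseq e (U i) Y"
          using U unfolding ball_block_subseqs_def by auto
        then obtain V \<alpha> where V: "\<And>i. i < k \<Longrightarrow> block_subseq e (V i) (U i)"
          "\<And>i l. i < k \<Longrightarrow> norm (V i l - f \<alpha> i l) \<le> \<delta> l" using * by metis
        \<comment> \<open>Tuples are extensional functions, so the values outside
          \<open>{..<k}\<close> have to be made undefined.\<close>
        define V' where "V' = restrict V {..<k}"
        have "V' \<in> tuples k (block_seqs e)"
          unfolding V'_def using V(1) by (auto simp: block_subseq_def)
        moreover have "\<forall>i<k. dist_le (V' i) (f \<alpha> i) \<delta>"
          unfolding V'_def dist_le_def using V(2) by simp
        ultimately have "V' \<in> expansion e k \<delta> F" unfolding expansion_def F by blast
        moreover have "\<forall>i<k. block_subseq e (V' i) (U i)" unfolding V'_def using V(1) by simp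
        moreover have "U \<in> tuples k (block_seqs e)"
          using U UY by (auto simp: block_subseq_def PiE_iff)
        ultimately show ?thesis unfolding upward_def by blast
      qed
      then show ?thesis by blast
    qed
    then show ?thesis using Y by blast
  qed
qed

end
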